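(* Let $\alpha>-1/2$, $p>4$ and $0<\delta<\frac14-\frac1p$. Then there is a function $f\in L^p(0,\infty)$ (with respect to Lebesgue measure) whose Laguerre expansion $\sum_{n=0}^\infty c_n(f)\,\mathcal{L}_n^\alpha(x)$ has Cesàro means of order $\delta$ and Riesz means of order $\delta$ which diverge for almost every $x\in(0,\infty)$.
   Context: For $\alpha>-1$, $L_n^{(\alpha)}$ denotes the Laguerre polynomial of degree $n$ (Szegő's normalization), orthogonal on $[0,\infty)$ with respect to $e^{-x}x^\alpha\,dx$, with $\int_0^\infty |L_n^{(\alpha)}(x)|^2e^{-x}x^\alpha\,dx=\Gamma(\alpha+1)\binom{n+\alpha}{n}$. The normalized Laguerre functions are $$\mathcal{L}_n^\alpha(x)=\sqrt{\frac{\Gamma(n+1)}{\Gamma(n+\alpha+1)}}\;e^{-x/2}x^{\alpha/2}L_n^{(\alpha)}(x),\qquad x\ge0,\ n\ge0,$$ which form an orthonormal set in $L^2([0,\infty))$ with Lebesgue measure. The coefficients of $f$ are $c_n(f)=\int_0^\infty f(x)\,\mathcal{L}_n^\alpha(x)\,dx$. The Cesàro means of order $\delta$ of the expansion are $$\sigma_N^\delta f(x)=\sum_{n=0}^N\frac{A_{N-n}^\delta}{A_N^\delta}\,c_n(f)\,\mathcal{L}_n^\alpha(x),\qquad A_n^\delta=\binom{n+\delta}{n},\quad N=0,1,2,\dots$$ and the Riesz means of order $\delta$ are, for real $r>0$, $$S_r^\delta f(x)=\sum_{0\le n<r}\left(1-\frac{n}{r}\right)^\delta c_n(f)\,\mathcal{L}_n^\alpha(x).$$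 "Diverge" means that $\sigma_N^\delta f(x)$ as $N\to\infty$ (respectively $S_r^\delta f(x)$ as $r\to\infty$) does not converge to a finite limit. "Almost every" is with respect to Lebesgue measure. *)

theory Defs
  imports "HOL-Analysis.Analysis" "HOL-Computational_Algebra.Polynomial"
begin

section \<open>Laguerre polynomials\<close>

text \<open>
  Szego's explicit formula
  $L_n^{(\alpha)}(x) = \sum_{k=0}^n \binom{n+\alpha}{n-k} \frac{(-x)^k}{k!}$.
  The lemmas below show that for \<open>\<alpha> > -1\<close> these are the polynomials of degree \<open>n\<close>,
  with leading coefficient of sign \<open>(-1)^n\<close>, that are orthogonal on the half-line with respect
  to the weight \<open>exp (-x) * x powr \<alpha>\<close> and have squared norm
  \<open>Gamma (\<alpha> + 1) * ((n + \<alpha>) gchoose n)\<close>.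
\<close>

definition laguerre_poly :: "real \<Rightarrow> nat \<Rightarrow> real poly" where
  "laguerre_poly \<alpha> n =
     (\<Sum>k\<le>n. monom (((real n + \<alpha>) gchoose (n - k)) * (-1) ^ k / fact k) k)"

lemma poly_laguerre_poly:
  "poly (laguerre_poly \<alpha> n) x =
     (\<Sum>k\<le>n. ((real n + \<alpha>) gchoose (n - k)) * (- x) ^ k / fact k)"
  unfolding laguerre_poly_def poly_sum poly_monom
  by (intro sum.cong refl) (simp add: power_minus[of x])

lemma coeff_laguerre_poly:
  "coeff (laguerre_poly \<alpha> n) k =
     (if k \<le> n then ((real n + \<alpha>) gchoose (n - k)) * (-1) ^ k / fact k else 0)"
  by (simp add: laguerre_poly_def coeff_sum coeff_monom if_distrib sum.If_cases)

lemma degree_laguerre_poly: "degree (laguerre_poly \<alpha> n) = n"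
proof (rule antisym)
  show "degree (laguerre_poly \<alpha> n) \<le> n"
    by (rule degree_le) (simp add: coeff_laguerre_poly)
  show "n \<le> degree (laguerre_poly \<alpha> n)"
    by (rule le_degree) (simp add: coeff_laguerre_poly)
qed

lemma lead_coeff_laguerre_poly: "lead_coeff (laguerre_poly \<alpha> n) = (-1) ^ n / fact n"
  by (simp add: degree_laguerre_poly coeff_laguerre_poly)

lemma alternating_sum_pochhammer:
  fixes x :: real
  shows "(\<Sum>k\<le>n. (-1) ^ k * real (n choose k) * pochhammer (x + real k) m) =
           (-1) ^ n * fact n * real (m choose n) * pochhammer (x + real n) (m - n)"
proof (induction n arbitrary: m x)
  case 0
  then show ?case by simp
next
  case (Suc n)
  let ?S = "\<lambda>n m x. \<Sum>k\<le>n. (-1) ^ k * real (n choose k) * pochhammer (x + real k) m"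
  have A: "?S (Suc n) m x = ?S n m x - ?S n m (x + 1)"
  proof -
    let ?T = "\<Sum>k\<le>n. (-1) ^ Suc k * real (n choose Suc k) * pochhammer (x + real (Suc k)) m"
    have 1: "pochhammer x m + ?T = ?S n m x"
    proof -
      have "?S n m x = (\<Sum>k\<le>Suc n. (-1) ^ k * real (n choose k) * pochhammer (x + real k) m)"
        by simp
      also have "\<dots> = pochhammer x m + ?T"
        by (subst sum.atMost_Suc_shift) simp
      finally show ?thesis by simp
    qed
    have 2: "?S n m (x + 1) =
        - (\<Sum>k\<le>n. (-1) ^ Suc k * real (n choose k) * pochhammer (x + real (Suc k)) m)"
      by (simp add: sum_negf algebra_simps)
    have "?S (Suc n) m x = pochhammer x m +
        (\<Sum>k\<le>n. (-1) ^ Suc k * real (Suc n choose Suc k) * pochhammer (x + real (Suc k)) m)"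
      by (subst sum.atMost_Suc_shift) simp
    also have "\<dots> = pochhammer x m + ?T +
        (\<Sum>k\<le>n. (-1) ^ Suc k * real (n choose k) * pochhammer (x + real (Suc k)) m)"
      by (simp only: binomial_Suc_Suc of_nat_add distrib_left distrib_right sum.distrib add_ac)
    finally show ?thesis using 1 2 by linarith
  qed
  show ?case
  proof (cases m)
    case 0
    then show ?thesis using A by simp
  next
    case (Suc m')
    have B: "pochhammer y m - pochhammer (y + 1) m = - real m * pochhammer (y + 1) m'" for y :: real
      using pochhammer_rec[of y m'] pochhammer_Suc[of "y + 1" m'] Suc by (simp add: algebra_simps)
    have "?S n m x - ?S n m (x + 1) = 
       (\<Sum>k\<le>n. (-1) ^ k * real (n choose k) * (pochhammer (x + real k) m - pochhammer (x + real k + 1) m))"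
      by (simp add: sum_subtractf algebra_simps)
    also have "\<dots> = - real m * ?S n m' (x + 1)"
      unfolding B by (simp add: sum_distrib_left sum_negf algebra_simps)
    also have "\<dots> = - real m * ((-1) ^ n * fact n * real (m' choose n) * pochhammer (x + 1 + real n) (m' - n))"
      by (simp only: Suc.IH)
    also have "\<dots> = (-1) ^ Suc n * fact n * (real m * real (m' choose n)) * pochhammer (x + real (Suc n)) (m - Suc n)"
      by (simp add: Suc algebra_simps)
    also have "real m * real (m' choose n) = real (Suc n) * real (m choose Suc n)"
      unfolding Suc by (metis Suc_times_binomial_eq mult.commute of_nat_mult)
    finally show ?thesis using A by (simp add: algebra_simps)
  qed
qed

lemma has_bochner_integral_moment:
  fixes \<alpha> :: real
  assumes "\<alpha> > -1"
  shows "has_bochner_integral (lebesgue_on {0<..})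
           (\<lambda>x. x ^ k * (exp (- x) * x powr \<alpha>)) (Gamma (\<alpha> + real k + 1))"
proof -
  let ?z = "\<alpha> + real k + 1"
  let ?f = "\<lambda>t::real. t powr (?z - 1) / exp t"
  have z: "?z > 0" using assms by simp
  have hi: "(?f has_integral Gamma ?z) {0<..}"
  proof -
    have "((\<lambda>x. if x \<in> {0<..} then ?f x else 0) has_integral Gamma ?z) {0..}"
      by (rule has_integral_spike[OF _ _ Gamma_integral_real[OF z], of "{0}"]) auto
    then show ?thesis by (subst (asm) has_integral_restrict) auto
  qed
  have "?f absolutely_integrable_on {0<..}"
    by (rule nonnegative_absolutely_integrable_1) (use hi in auto)
  then have "integrable (lebesgue_on {0<..}) ?f"
    by (simp add: integrable_restrict_space set_integrable_def)
  then have "has_bochner_integral (lebesgue_on {0<..}) ?f (Gamma ?z)"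
    using hi by (simp add: has_bochner_integral_iff lebesgue_integral_eq_integral integral_unique)
  moreover have "?f x = x ^ k * (exp (- x) * x powr \<alpha>)" if "x \<in> {0<..}" for x
    using that by (simp add: exp_minus powr_add powr_realpow field_simps)
  ultimately show ?thesis
    by (subst has_bochner_integral_cong[where N = "lebesgue_on {0<..}" and g = ?f and y = "Gamma ?z"])
       (auto simp: space_restrict_space)
qed

lemma has_bochner_integral_laguerre_poly_power:
  assumes "\<alpha> > -1" "m \<le> n"
  shows "has_bochner_integral (lebesgue_on {0<..})
           (\<lambda>x. poly (laguerre_poly \<alpha> n) x * x ^ m * (exp (- x) * x powr \<alpha>))
           (if m = n then (-1) ^ n * Gamma (real n + \<alpha> + 1) else 0)"
proof -
  let ?c = "\<lambda>k. ((real n + \<alpha>) gchoose (n - k)) * (-1) ^ k / fact k"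
  have "has_bochner_integral (lebesgue_on {0<..})
          (\<lambda>x. \<Sum>k\<le>n. ?c k * (x ^ (k + m) * (exp (- x) * x powr \<alpha>)))
          (\<Sum>k\<le>n. ?c k * Gamma (\<alpha> + real (k + m) + 1))"
    by (intro has_bochner_integral_sum has_bochner_integral_mult_right
              has_bochner_integral_moment assms)
  also have "(\<lambda>x. \<Sum>k\<le>n. ?c k * (x ^ (k + m) * (exp (- x) * x powr \<alpha>))) =
      (\<lambda>x. poly (laguerre_poly \<alpha> n) x * x ^ m * (exp (- x) * x powr \<alpha>))"
    by (rule ext)
       (simp only: laguerre_poly_def poly_sum poly_monom sum_distrib_left sum_distrib_right power_add mult_ac)
  also have "(\<Sum>k\<le>n. ?c k * Gamma (\<alpha> + real (k + m) + 1)) =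
      Gamma (real n + \<alpha> + 1) / fact n *
      (\<Sum>k\<le>n. (-1) ^ k * real (n choose k) * pochhammer (\<alpha> + 1 + real k) m)"
    unfolding sum_distrib_left
  proof (intro sum.cong refl)
    fix k assume "k \<in> {..n}"
    then have k: "k \<le> n" by simp
    have pos: "\<alpha> + 1 + real k > 0" using assms(1) by simp
    have nz: "\<alpha> + 1 + real k \<notin> \<int>\<^sub>\<le>\<^sub>0" "real n + \<alpha> + 1 \<notin> \<int>\<^sub>\<le>\<^sub>0"
      using assms(1) by (auto elim!: nonpos_Ints_cases)
    have G: "Gamma (\<alpha> + 1 + real k) > 0" using pos by simp
    have c: "((real n + \<alpha>) gchoose (n - k)) =
            Gamma (real n + \<alpha> + 1) / (fact (n - k) * Gamma (\<alpha> + 1 + real k))"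
      using nz(2) k by (subst gbinomial_Gamma) (auto simp: of_nat_diff algebra_simps)
    have p: "Gamma (\<alpha> + real (k + m) + 1) =
               pochhammer (\<alpha> + 1 + real k) m * Gamma (\<alpha> + 1 + real k)"
      using pochhammer_Gamma[OF nz(1)] G by (simp add: algebra_simps)
    show "?c k * Gamma (\<alpha> + real (k + m) + 1) = Gamma (real n + \<alpha> + 1) / fact n *
        ((-1) ^ k * real (n choose k) * pochhammer (\<alpha> + 1 + real k) m)"
      unfolding c p using G k by (simp add: binomial_fact)
  qed
  also have "\<dots> = (if m = n then (-1) ^ n * Gamma (real n + \<alpha> + 1) else 0)"
    using assms(2) by (simp add: alternating_sum_pochhammer binomial_eq_0)
  finally show ?thesis .
qed

lemma laguerre_poly_orthogonal:
  assumes "\<alpha> > -1"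
  shows "has_bochner_integral (lebesgue_on {0<..})
           (\<lambda>x. poly (laguerre_poly \<alpha> m) x * poly (laguerre_poly \<alpha> n) x * (exp (- x) * x powr \<alpha>))
           (if m = n then Gamma (\<alpha> + 1) * ((real n + \<alpha>) gchoose n) else 0)"
proof (induction m n rule: linorder_wlog)
  case (le m n)
  let ?q = "laguerre_poly \<alpha> m"
  have "has_bochner_integral (lebesgue_on {0<..})
          (\<lambda>x. \<Sum>k\<le>m. coeff ?q k *
             (poly (laguerre_poly \<alpha> n) x * x ^ k * (exp (- x) * x powr \<alpha>)))
          (\<Sum>k\<le>m. coeff ?q k * (if k = n then (-1) ^ n * Gamma (real n + \<alpha> + 1) else 0))"
    by (intro has_bochner_integral_sum has_bochner_integral_mult_right
              has_bochner_integral_laguerre_poly_power assms) (use le in auto)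
  also have "(\<lambda>x. \<Sum>k\<le>m. coeff ?q k *
             (poly (laguerre_poly \<alpha> n) x * x ^ k * (exp (- x) * x powr \<alpha>))) =
      (\<lambda>x. poly ?q x * poly (laguerre_poly \<alpha> n) x * (exp (- x) * x powr \<alpha>))"
    by (rule ext) (simp only: poly_altdef[of ?q] degree_laguerre_poly[of \<alpha> m] sum_distrib_left sum_distrib_right mult_ac)
  also have "(\<Sum>k\<le>m. coeff ?q k * (if k = n then (-1) ^ n * Gamma (real n + \<alpha> + 1) else 0)) =
      (if m = n then coeff ?q n * ((-1) ^ n * Gamma (real n + \<alpha> + 1)) else 0)"
    using le by (simp add: mult_delta_right)
  also have "\<dots> = (if m = n then Gamma (real n + \<alpha> + 1) / fact n else 0)"
    by (simp add: coeff_laguerre_poly)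
  also have "Gamma (real n + \<alpha> + 1) / fact n = Gamma (\<alpha> + 1) * ((real n + \<alpha>) gchoose n)"
  proof -
    have "real n + \<alpha> + 1 \<notin> \<int>\<^sub>\<le>\<^sub>0" using assms by (auto elim!: nonpos_Ints_cases)
    moreover have "Gamma (\<alpha> + 1) > 0" using assms by simp
    ultimately show ?thesis by (subst gbinomial_Gamma) auto
  qed
  finally show ?case .
next
  case (sym m n)
  then show ?case by (auto simp: mult_ac split: if_splits)
qed


section \<open>Laguerre functions and expansions\<close>

text \<open>
  The Laguerre functions are only used on \<open>{0<..}\<close>; at \<open>x = 0\<close> the convention
  \<open>0 powr 0 = 0\<close> would give a wrong value for \<open>\<alpha> = 0\<close>.
\<close>

definition laguerre_fun :: "real \<Rightarrow> nat \<Rightarrow> real \<Rightarrow> real" where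
  "laguerre_fun \<alpha> n x =
     sqrt (Gamma (real n + 1) / Gamma (real n + \<alpha> + 1)) *
     exp (- x / 2) * x powr (\<alpha> / 2) * poly (laguerre_poly \<alpha> n) x"

lemma laguerre_fun_orthonormal:
  assumes "\<alpha> > -1"
  shows "has_bochner_integral (lebesgue_on {0<..})
           (\<lambda>x. laguerre_fun \<alpha> m x * laguerre_fun \<alpha> n x) (if m = n then 1 else 0)"
proof -
  let ?C = "\<lambda>n. sqrt (Gamma (real n + 1) / Gamma (real n + \<alpha> + 1))"
  have "real n + \<alpha> + 1 \<notin> \<int>\<^sub>\<le>\<^sub>0" using assms by (auto elim!: nonpos_Ints_cases)
  moreover have pos: "Gamma (\<alpha> + 1) > 0" "Gamma (real n + \<alpha> + 1) > 0" "Gamma (real n + 1) > 0"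
    using assms by simp_all
  ultimately have norm: "Gamma (\<alpha> + 1) * ((real n + \<alpha>) gchoose n) =
      Gamma (real n + \<alpha> + 1) / Gamma (real n + 1)"
    by (subst gbinomial_Gamma) (auto simp: Gamma_fact add.commute)
  have "has_bochner_integral (lebesgue_on {0<..})
      (\<lambda>x. ?C m * ?C n * (poly (laguerre_poly \<alpha> m) x * poly (laguerre_poly \<alpha> n) x *
             (exp (- x) * x powr \<alpha>)))
      (?C m * ?C n * (if m = n then Gamma (\<alpha> + 1) * ((real n + \<alpha>) gchoose n) else 0))"
    by (intro has_bochner_integral_mult_right laguerre_poly_orthogonal assms)
  also have "(\<lambda>x. ?C m * ?C n * (poly (laguerre_poly \<alpha> m) x * poly (laguerre_poly \<alpha> n) x *
             (exp (- x) * x powr \<alpha>))) = (\<lambda>x. laguerre_fun \<alpha> m x * laguerre_fun \<alpha> n x)"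
  proof
    fix x :: real
    have "exp (- x) = exp (- x / 2) * exp (- x / 2)" "x powr \<alpha> = x powr (\<alpha> / 2) * x powr (\<alpha> / 2)"
      by (simp_all flip: exp_add powr_add)
    then show "?C m * ?C n * (poly (laguerre_poly \<alpha> m) x * poly (laguerre_poly \<alpha> n) x *
             (exp (- x) * x powr \<alpha>)) = laguerre_fun \<alpha> m x * laguerre_fun \<alpha> n x"
      by (simp only: laguerre_fun_def mult_ac)
  qed
  also have "?C m * ?C n * (if m = n then Gamma (\<alpha> + 1) * ((real n + \<alpha>) gchoose n) else 0) =
      (if m = n then 1 else 0)"
    using pos(2) less_imp_neq[OF pos(3)] unfolding norm by auto
  finally show ?thesis .
qed

definition laguerre_coeff :: "real \<Rightarrow> (real \<Rightarrow> real) \<Rightarrow> nat \<Rightarrow> real" where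
  "laguerre_coeff \<alpha> f n = (LINT x|lebesgue_on {0<..}. f x * laguerre_fun \<alpha> n x)"

definition cesaro_number :: "real \<Rightarrow> nat \<Rightarrow> real" where
  "cesaro_number \<delta> n = (real n + \<delta>) gchoose n"

definition cesaro_mean :: "real \<Rightarrow> real \<Rightarrow> (real \<Rightarrow> real) \<Rightarrow> nat \<Rightarrow> real \<Rightarrow> real" where
  "cesaro_mean \<alpha> \<delta> f N x =
     (\<Sum>n\<le>N. cesaro_number \<delta> (N - n) / cesaro_number \<delta> N * laguerre_coeff \<alpha> f n * laguerre_fun \<alpha> n x)"

definition riesz_mean :: "real \<Rightarrow> real \<Rightarrow> (real \<Rightarrow> real) \<Rightarrow> real \<Rightarrow> real \<Rightarrow> real" where
  "riesz_mean \<alpha> \<delta> f r x =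
     (\<Sum>n | real n < r. (1 - real n / r) powr \<delta> * laguerre_coeff \<alpha> f n * laguerre_fun \<alpha> n x)"

lemma finite_riesz_index: "finite {n::nat. real n < r}"
proof (rule finite_subset)
  show "{n::nat. real n < r} \<subseteq> {..nat \<lceil>r\<rceil>}"
  proof
    fix n assume "n \<in> {n::nat. real n < r}"
    then have "real n \<le> real (nat \<lceil>r\<rceil>)"
      using real_nat_ceiling_ge[of r] by (simp only: mem_Collect_eq)
    then show "n \<in> {..nat \<lceil>r\<rceil>}" by simp
  qed
qed simp

definition in_Lp :: "real \<Rightarrow> 'a measure \<Rightarrow> ('a \<Rightarrow> real) \<Rightarrow> bool" where
  "in_Lp p M f \<longleftrightarrow> f \<in> borel_measurable M \<and> integrable M (\<lambda>x. \<bar>f x\<bar> powr p)"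

end

theory Submission
  imports Defs
begin

text \<open>
  If the Cesaro or Riesz means of order \<open>\<delta>\<close> of a series converge, its terms are \<open>O(n powr \<delta>)\<close>: the
  first differences of the summation weights are log-convex, so by Kaluza's theorem the
  reciprocal power series has absolutely summable coefficients and the means can be inverted.
  It is therefore enough to find \<open>f\<close> in \<open>L\<^sup>p\<close> whose terms \<open>c\<^sub>n(f) L\<^sub>n(x)\<close> grow faster than
  \<open>n powr \<delta>\<close> along a subsequence, for almost every \<open>x\<close>.

  The function \<open>v(s) = sqrt s * L\<^sub>n(s\<^sup>2)\<close> solves \<open>v'' = - Q v\<close> with \<open>Q\<close> of order \<open>n\<close> for
  \<open>s \<le> sqrt n\<close>, and a Gronwall argument shows that its energy is comparable at all points from
  \<open>s ~ 1 / sqrt n\<close>, where it is at least of order \<open>sqrt n\<close> by the explicit polynomial, up to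
  \<open>sqrt n\<close>. Since \<open>v'\<close> is large where \<open>v\<close> is small, \<open>\<bar>L\<^sub>n(x)\<bar>\<close> falls below
  \<open>\<eta> * (n x) powr (- 1/4)\<close> only on a set of relative measure \<open>O(\<eta>)\<close>. Along a sparse sequence
  \<open>N k\<close>, Borel-Cantelli turns this into \<open>\<bar>L\<^sub>n(x)\<bar> > c(x) * n powr (- 1/4 - \<epsilon>)\<close> eventually, for almost
  every \<open>x\<close>, and the same bound on \<open>[n/4, n]\<close> gives that interval an \<open>L\<^sup>1\<close> mass of order
  \<open>sqrt n\<close>. Gluing the signs of \<open>L\<^sub>n\<close> on the intervals \<open>[n/4, n]\<close>, \<open>n = N k\<close>, with the weight
  \<open>x powr (- 1/p - \<epsilon>)\<close> produces \<open>f\<close> with \<open>c\<^sub>n(f)\<close> of order at least \<open>n powr (1/2 - 1/p - \<epsilon>)\<close>.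
\<close>

section \<open>Inversion of Cesaro and Riesz means\<close>

text \<open>Kaluza's theorem. The ratios \<open>d (n + 1) / d n\<close> increase, so multiplying the \<open>m\<close>-th convolution
  identity by the largest ratio and subtracting it from the next one leaves terms of one sign.\<close>

lemma kaluza_coeff:
  fixes d :: "nat \<Rightarrow> real"
  assumes d0: "d 0 = 1" and pos: "\<And>n. d n > 0"
    and logconvex: "\<And>n. (d (Suc n))\<^sup>2 \<le> d n * d (Suc (Suc n))"
    and n: "n > 0"
  shows "fps_nth (inverse (Abs_fps d)) n \<le> 0"
  using n
proof (induction n rule: less_induct)
  case (less n)
  define E where "E = fps_nth (inverse (Abs_fps d))"
  have E0: "E 0 = 1" by (simp add: E_def d0)
  have conv: "(\<Sum>i\<le>k. E i * d (k - i)) = (if k = 0 then 1 else 0)" for k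
  proof -
    have "inverse (Abs_fps d) * Abs_fps d = 1"
      by (rule inverse_mult_eq_1) (simp add: d0)
    then have "fps_nth (inverse (Abs_fps d) * Abs_fps d) k = fps_nth 1 k" by simp
    then show ?thesis by (simp add: fps_mult_nth E_def atLeast0AtMost)
  qed
  have ratio: "d (Suc i) / d i \<le> d (Suc j) / d j" if "i \<le> j" for i j
    using that
  proof (rule lift_Suc_mono_le[of "\<lambda>i. d (Suc i) / d i", rotated])
    fix i show "d (Suc i) / d i \<le> d (Suc (Suc i)) / d (Suc i)"
      using pos[of i] pos[of "Suc i"] logconvex[of i] by (simp add: field_simps power2_eq_square)
  qed
  from less.prems obtain m where m: "n = Suc m" by (cases n) auto
  have "E n = - (\<Sum>i\<le>m. E i * d (Suc m - i))"
    using conv[of n] by (simp add: m d0)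
  moreover have "(\<Sum>i\<le>m. E i * d (Suc m - i)) \<ge> 0"
  proof (cases "m = 0")
    case True
    then show ?thesis using pos[of 1] by (simp add: E0)
  next
    case False
    let ?r = "d (Suc m) / d m"
    have "(\<Sum>i\<le>m. E i * d (Suc m - i)) = (\<Sum>i\<le>m. E i * d (Suc m - i)) - ?r * (\<Sum>i\<le>m. E i * d (m - i))"
      using conv[of m] False by simp
    also have "\<dots> = (\<Sum>i\<le>m. E i * (d (Suc m - i) - ?r * d (m - i)))"
      by (simp add: sum_distrib_left sum_subtractf algebra_simps)
    also have "\<dots> \<ge> 0"
    proof (rule sum_nonneg)
      fix i assume "i \<in> {..m}"
      show "0 \<le> E i * (d (Suc m - i) - ?r * d (m - i))"
      proof (cases "i = 0")
        case True
        then show ?thesis using pos[of m] by simp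
      next
        case False
        then have "E i \<le> 0" using less.IH[of i] \<open>i \<in> {..m}\<close> m by (simp add: E_def)
        moreover have "d (Suc m - i) - ?r * d (m - i) \<le> 0"
          using ratio[of "m - i" m] pos[of "m - i"] \<open>i \<in> {..m}\<close>
          by (simp add: Suc_diff_le divide_le_eq)
        ultimately show ?thesis by (rule mult_nonpos_nonpos)
      qed
    qed
    finally show ?thesis .
  qed
  ultimately show ?case by (simp add: E_def)
qed

text \<open>In terms of generating series, \<open>d\<close> is the difference sequence of
  \<open>w\<close>, so \<open>(1 - fps_X) * W = D\<close> and
  \<open>A = E * ((1 - fps_X) * (W * A))\<close> with \<open>E = inverse D\<close>. The differencing
  costs a factor 2 and the absolute sum of the coefficients of \<open>E\<close> another factor 2.
  Both kinds of means are reduced to this form.\<close>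

lemma kaluza_inversion:
  fixes d w a :: "nat \<Rightarrow> real"
  assumes d0: "d 0 = 1" and pos: "\<And>n. d n > 0" and dec: "decseq d"
    and logconvex: "\<And>n. (d (Suc n))\<^sup>2 \<le> d n * d (Suc (Suc n))"
    and w: "\<And>n. w n = (\<Sum>k\<le>n. d k)"
    and bound: "\<And>n. n \<le> N \<Longrightarrow> \<bar>\<Sum>k\<le>n. w (n - k) * a k\<bar> \<le> M"
  shows "\<bar>a N\<bar> \<le> 4 * M"
proof -
  define D E W A where "D = Abs_fps d" and "E = inverse D" and "W = Abs_fps w" and "A = Abs_fps a"
  have ED: "E * D = 1" unfolding E_def by (rule inverse_mult_eq_1) (simp add: D_def d0)
  have E0: "fps_nth E 0 = 1" by (simp add: E_def D_def d0)
  have Eneg: "fps_nth E i \<le> 0" if "i > 0" for i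
    using kaluza_coeff[OF d0 pos logconvex that] by (simp add: E_def D_def)
  have "(1 - fps_X) * W = D"
    by (rule fps_ext) (case_tac n; simp add: left_diff_distrib W_def D_def w)
  then have A: "A = E * ((1 - fps_X) * (W * A))"
    using ED by (metis mult.assoc mult_1)
  have B: "fps_nth (W * A) n = (\<Sum>k\<le>n. w (n - k) * a k)" for n
    by (subst mult.commute) (simp add: fps_mult_nth W_def A_def mult.commute atLeast0AtMost)
  have B1: "\<bar>fps_nth ((1 - fps_X) * (W * A)) n\<bar> \<le> 2 * M" if "n \<le> N" for n
  proof -
    have "fps_nth ((1 - fps_X) * (W * A)) n = fps_nth (W * A) n - (if n = 0 then 0 else fps_nth (W * A) (n - 1))"
      by (simp add: left_diff_distrib)
    moreover have "\<bar>fps_nth (W * A) n\<bar> \<le> M" "\<bar>fps_nth (W * A) (n - 1)\<bar> \<le> M"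
      unfolding B using bound[of n] bound[of "n - 1"] that by auto
    ultimately show ?thesis by auto
  qed
  have M: "M \<ge> 0" using bound[of 0] by simp
  \<comment> \<open>All coefficients of \<open>E\<close> after the first are nonpositive, so the
    \<open>N\<close>-th coefficient of \<open>E * D = 1\<close> expresses \<open>d N\<close> as a
    sum of \<open>\<bar>fps_nth E i\<bar> * d (N - i)\<close>. Since \<open>d\<close> decreases,
    these coefficients have total mass at most 1.\<close>
  have sumE: "(\<Sum>i\<le>N. \<bar>fps_nth E i\<bar>) \<le> 2"
  proof (cases "N = 0")
    case False
    have "(\<Sum>i\<le>N. fps_nth E i * d (N - i)) = 0"
      using ED False by (metis (no_types, lifting) D_def fps_mult_nth fps_nth_Abs_fps fps_one_nth sum.cong atLeast0AtMost)
    then have "d N = (\<Sum>i\<in>{1..N}. \<bar>fps_nth E i\<bar> * d (N - i))"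
      using Eneg E0 by (subst (asm) atMost_atLeast0, subst (asm) sum.atLeast_Suc_atMost) (auto simp: sum_negf intro!: sum.cong)
    also have "\<dots> \<ge> (\<Sum>i\<in>{1..N}. \<bar>fps_nth E i\<bar> * d N)"
      using dec by (intro sum_mono mult_left_mono) (auto simp: decseq_def)
    finally have "(\<Sum>i\<in>{1..N}. \<bar>fps_nth E i\<bar>) * d N \<le> 1 * d N"
      by (simp add: sum_distrib_right)
    then have "(\<Sum>i\<in>{1..N}. \<bar>fps_nth E i\<bar>) \<le> 1"
      using pos[of N] mult_le_cancel_right_pos by blast
    then show ?thesis
      using E0 by (subst atMost_atLeast0, subst sum.atLeast_Suc_atMost) auto
  qed (simp add: E0)
  have "\<bar>a N\<bar> = \<bar>\<Sum>i\<le>N. fps_nth E i * fps_nth ((1 - fps_X) * (W * A)) (N - i)\<bar>"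
    using arg_cong[OF A, of "\<lambda>f. fps_nth f N"] by (simp only: fps_mult_nth[of E] atLeast0AtMost) (simp add: A_def)
  also have "\<dots> \<le> (\<Sum>i\<le>N. \<bar>fps_nth E i\<bar> * (2 * M))"
    unfolding abs_mult[symmetric]
    by (rule order.trans[OF sum_abs]) (auto simp: abs_mult intro!: sum_mono mult_left_mono B1)
  also have "\<dots> = (\<Sum>i\<le>N. \<bar>fps_nth E i\<bar>) * (2 * M)" by (simp add: sum_distrib_right)
  also have "\<dots> \<le> 2 * (2 * M)" using sumE M by (intro mult_right_mono) auto
  finally show ?thesis by simp
qed

section \<open>Riesz weights\<close>

lemma powr_diff_decseq:
  fixes \<delta> :: real
  assumes "0 < \<delta>" "\<delta> < 1"
  shows "decseq (\<lambda>k. (real k + 1) powr \<delta> - real k powr \<delta>)"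
proof (rule decseq_SucI)
  fix k :: nat
  let ?G = "\<lambda>t. (real k + t) powr \<delta> - (real k + 1 + t) powr \<delta>"
  have "?G 0 \<le> ?G 1"
  \<comment> \<open>For \<open>k = 0\<close> the derivative does not exist at \<open>t = 0\<close>;
    hence the criterion that asks only for continuity at the endpoints.\<close>
  proof (rule DERIV_nonneg_imp_increasing_open[of 0 1 ?G])
    fix t :: real assume t: "0 < t" "t < 1"
    have "(?G has_real_derivative \<delta> * ((real k + t) powr (\<delta> - 1) - (real k + 1 + t) powr (\<delta> - 1))) (at t)"
      using t by (auto intro!: derivative_eq_intros simp: algebra_simps)
    moreover have "(real k + 1 + t) powr (\<delta> - 1) \<le> (real k + t) powr (\<delta> - 1)"
      using t assms by (intro powr_mono2') auto
    ultimately show "\<exists>y. (?G has_real_derivative y) (at t) \<and> 0 \<le> y"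
      using assms by (intro exI conjI) auto
  qed (use assms in \<open>auto intro!: continuous_intros continuous_on_powr'\<close>)
  then show "(real (Suc k) + 1) powr \<delta> - real (Suc k) powr \<delta> \<le> (real k + 1) powr \<delta> - real k powr \<delta>"
    by (simp add: add_ac)
qed

text \<open>\<open>d k\<close> is the integral over [0, 1] of
  \<open>\<delta> * (k + t) powr (\<delta> - 1)\<close>. The integrand is log-convex in
  \<open>k\<close>, and this property survives integration over \<open>t\<close>.\<close>

lemma powr_diff_logconvex:
  fixes \<delta> :: real
  assumes "0 < \<delta>" "\<delta> < 1"
  defines "d \<equiv> \<lambda>k. (real k + 1) powr \<delta> - real k powr \<delta>"
  shows "(d (Suc k))\<^sup>2 \<le> d k * d (Suc (Suc k))"
proof -
  have pos: "d k > 0" for k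
    using assms(1) by (auto simp: d_def intro!: powr_less_mono2)
  txt \<open>This weight makes \<open>l * d k = d (Suc (Suc k)) / l\<close>, so that AM-GM applied to the derivative
    of \<open>?G\<close> gives back the geometric mean after integration.\<close>
  define l where "l = sqrt (d (Suc (Suc k)) / d k)"
  have l: "l > 0" "l\<^sup>2 = d (Suc (Suc k)) / d k" using pos by (auto simp: l_def less_imp_le)
  let ?G = "\<lambda>t. l * (real k + t) powr \<delta> + (real k + 2 + t) powr \<delta> / l - 2 * (real k + 1 + t) powr \<delta>"
  have "?G 0 \<le> ?G 1"
  proof (rule DERIV_nonneg_imp_increasing_open[of 0 1 ?G])
    fix t :: real assume t: "0 < t" "t < 1"
    let ?u = "real k + t"
    have "(?G has_real_derivative \<delta> * (l * ?u powr (\<delta> - 1) + (real k + 2 + t) powr (\<delta> - 1) / l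
             - 2 * (real k + 1 + t) powr (\<delta> - 1))) (at t)"
      using t l(1) by (auto intro!: derivative_eq_intros simp: algebra_simps)
    moreover have "2 * (real k + 1 + t) powr (\<delta> - 1) \<le> l * ?u powr (\<delta> - 1) + (real k + 2 + t) powr (\<delta> - 1) / l"
    proof -
      \<comment> \<open>\<open>?p\<close> and \<open>?q\<close> are the square roots of the two
        outer values. The middle value is at most \<open>?p * ?q\<close> because
        \<open>(k + 1 + t)^2\<close> exceeds \<open>(k + t) * (k + 2 + t)\<close> and the exponent
        is negative.\<close>
      let ?p = "?u powr ((\<delta> - 1) / 2)" and ?q = "(real k + 2 + t) powr ((\<delta> - 1) / 2)"
      have "(real k + 1 + t) powr (\<delta> - 1) = ((real k + 1 + t)\<^sup>2) powr ((\<delta> - 1) / 2)"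
        using t by (simp add: powr_powr diff_divide_distrib flip: powr_numeral)
      also have "\<dots> \<le> (?u * (real k + 2 + t)) powr ((\<delta> - 1) / 2)"
        using t assms(2) by (intro powr_mono2' mult_pos_pos) (auto simp: power2_eq_square algebra_simps)
      also have "\<dots> = ?p * ?q" using t by (simp add: powr_mult)
      finally have 1: "(real k + 1 + t) powr (\<delta> - 1) \<le> ?p * ?q" .
      have "0 \<le> (l * ?p - ?q)\<^sup>2 / l" using l by simp
      also have "\<dots> = l * ?p\<^sup>2 + ?q\<^sup>2 / l - 2 * (?p * ?q)"
        using l(1) by (simp add: power2_eq_square field_simps)
      also have "?p\<^sup>2 = ?u powr (\<delta> - 1)" using t by (simp add: powr_powr power2_eq_square flip: powr_add)
      also have "?q\<^sup>2 = (real k + 2 + t) powr (\<delta> - 1)" by (simp add: power2_eq_square flip: powr_add)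
      finally show ?thesis using 1 by simp
    qed
    ultimately show "\<exists>y. (?G has_real_derivative y) (at t) \<and> 0 \<le> y"
      using assms(1) by (intro exI conjI) auto
  qed (use assms(1) l in \<open>auto intro!: continuous_intros continuous_on_powr'\<close>)
  then have "2 * d (Suc k) \<le> l * d k + d (Suc (Suc k)) / l"
    by (simp add: d_def algebra_simps diff_divide_distrib)
  also have "d (Suc (Suc k)) = l\<^sup>2 * d k" using l(2) pos[of k] by simp
  also have "l * d k + l\<^sup>2 * d k / l = 2 * (l * d k)" using l(1) by (simp add: power2_eq_square)
  finally have "(d (Suc k))\<^sup>2 \<le> (l * d k)\<^sup>2" using pos[of "Suc k"] by (intro power_mono) auto
  also have "\<dots> = d k * d (Suc (Suc k))"
    using l(2) pos[of k] by (simp add: power_mult_distrib) (simp add: power2_eq_square)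
  finally show ?thesis .
qed

text \<open>At radius \<open>n + 1\<close> the Riesz weights, multiplied by
  \<open>(n + 1) powr \<delta>\<close>, become \<open>(n - k + 1) powr \<delta>\<close>. These
  depend on \<open>n - k\<close> only, so the sum is a convolution.\<close>

lemma riesz_inversion:
  fixes \<delta> M :: real and a :: "nat \<Rightarrow> real"
  assumes \<delta>: "0 < \<delta>" "\<delta> < 1"
    and bound: "\<And>n. \<bar>\<Sum>k\<le>n. (1 - real k / (real n + 1)) powr \<delta> * a k\<bar> \<le> M"
  shows "\<bar>a N\<bar> \<le> 4 * M * (real N + 1) powr \<delta>"
proof -
  let ?d = "\<lambda>k::nat. (real k + 1) powr \<delta> - real k powr \<delta>"
  have M: "M \<ge> 0" using bound[of 0] by simp
  have "\<bar>a N\<bar> \<le> 4 * (M * (real N + 1) powr \<delta>)"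
  proof (rule kaluza_inversion[where d = ?d and w = "\<lambda>k. (real k + 1) powr \<delta>"])
    show "decseq ?d" using powr_diff_decseq[OF \<delta>] .
    show "(?d (Suc n))\<^sup>2 \<le> ?d n * ?d (Suc (Suc n))" for n using powr_diff_logconvex[OF \<delta>] .
    show "?d n > 0" for n using \<delta> by (auto intro!: powr_less_mono2)
    show "(real n + 1) powr \<delta> = (\<Sum>k\<le>n. ?d k)" for n
      by (induction n) (auto simp: add_ac)
    fix n assume n: "n \<le> N"
    have "(real (n - k) + 1) powr \<delta> = (real n + 1) powr \<delta> * (1 - real k / (real n + 1)) powr \<delta>" if "k \<le> n" for k
    proof -
      have "real (n - k) + 1 = (real n + 1) * (1 - real k / (real n + 1))"
        using that by (simp add: right_diff_distrib of_nat_diff)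
      then show ?thesis by (simp only: powr_mult)
    qed
    then have "(\<Sum>k\<le>n. (real (n - k) + 1) powr \<delta> * a k) =
        (real n + 1) powr \<delta> * (\<Sum>k\<le>n. (1 - real k / (real n + 1)) powr \<delta> * a k)"
      unfolding sum_distrib_left by (intro sum.cong) auto
    then have "\<bar>\<Sum>k\<le>n. (real (n - k) + 1) powr \<delta> * a k\<bar> \<le> (real n + 1) powr \<delta> * M"
      using bound[of n] by (simp add: abs_mult)
    also have "\<dots> \<le> (real N + 1) powr \<delta> * M"
      using n \<delta> M by (intro mult_right_mono powr_mono2) auto
    finally show "\<bar>\<Sum>k\<le>n. (real (n - k) + 1) powr \<delta> * a k\<bar> \<le> M * (real N + 1) powr \<delta>"
      by (simp add: mult.commute)
  qed auto
  then show ?thesis by simp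
qed

section \<open>Cesaro weights\<close>

lemma cesaro_number_Suc:
  "cesaro_number \<delta> (Suc n) = cesaro_number \<delta> n * (1 + \<delta> / (real n + 1))"
  using Suc_times_gbinomial[of n "real n + \<delta>"]
  by (simp add: cesaro_number_def add_ac field_simps)

text \<open>The step ratio \<open>1 + \<delta> / (n + 2)\<close> is at most
  \<open>((n + 2) / (n + 1)) powr \<delta>\<close>, because \<open>ln (1 + 1 / (n + 1))\<close> is
  at least \<open>1 / (n + 2)\<close>. The induction therefore runs with the index shifted by one,
  and the constant 2 covers its start \<open>1 + \<delta>\<close>.\<close>

lemma cesaro_number_le:
  assumes "0 < \<delta>" "\<delta> < 1"
  shows "cesaro_number \<delta> n \<le> 2 * (real n + 1) powr \<delta>"
proof -
  have step: "cesaro_number \<delta> (Suc n) \<le> 2 * (real n + 1) powr \<delta>" for n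
  proof (induction n)
    case 0
    then show ?case using assms by (simp add: cesaro_number_def)
  next
    case (Suc n)
    have "- ln (1 + 1 / (real n + 1)) \<le> - (1 / (real (Suc n) + 1))"
      using ln_le_minus_one[where x = "1 / (1 + 1 / (real n + 1))"] by (simp add: ln_div field_simps)
    then have "1 + \<delta> / (real (Suc n) + 1) \<le> 1 + \<delta> * ln (1 + 1 / (real n + 1))"
      using mult_left_mono[of "1 / (real (Suc n) + 1)" "ln (1 + 1 / (real n + 1))" \<delta>] assms(1) by simp
    also have "\<dots> \<le> exp (\<delta> * ln (1 + 1 / (real n + 1)))" by (rule exp_ge_add_one_self)
    also have "\<dots> = (1 + 1 / (real n + 1)) powr \<delta>" by (simp add: powr_def add_nonneg_eq_0_iff)
    also have "1 + 1 / (real n + 1) = (real (Suc n) + 1) / (real n + 1)" by (simp add: field_simps)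
    finally have r: "1 + \<delta> / (real (Suc n) + 1) \<le> (real (Suc n) + 1) powr \<delta> / (real n + 1) powr \<delta>"
      by (simp add: powr_divide)
    have "cesaro_number \<delta> (Suc (Suc n)) = cesaro_number \<delta> (Suc n) * (1 + \<delta> / (real (Suc n) + 1))"
      by (rule cesaro_number_Suc)
    also have "\<dots> \<le> 2 * (real n + 1) powr \<delta> * ((real (Suc n) + 1) powr \<delta> / (real n + 1) powr \<delta>)"
      using Suc r assms(1) by (intro mult_mono) auto
    finally show ?case by simp
  qed
  show ?thesis
  proof (cases n)
    case (Suc m)
    have "(real m + 1) powr \<delta> \<le> (real n + 1) powr \<delta>" using Suc assms by (intro powr_mono2) auto
    then show ?thesis using step[of m] Suc by simp
  qed (simp add: cesaro_number_def)
qed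

text \<open>The differences of the Cesaro numbers of order \<open>\<delta>\<close> are those of
  order \<open>\<delta> - 1\<close>. Their ratios \<open>1 + (\<delta> - 1) / (n + 1)\<close> stay
  below 1 and increase, which gives monotonicity and log-convexity at once.\<close>

lemma cesaro_inversion:
  fixes \<delta> M :: real and a :: "nat \<Rightarrow> real"
  assumes \<delta>: "0 < \<delta>" "\<delta> < 1"
    and bound: "\<And>n. \<bar>\<Sum>k\<le>n. cesaro_number \<delta> (n - k) / cesaro_number \<delta> n * a k\<bar> \<le> M"
  shows "\<bar>a N\<bar> \<le> 8 * M * (real N + 1) powr \<delta>"
proof -
  let ?w = "cesaro_number \<delta>" and ?d = "cesaro_number (\<delta> - 1)"
  have w0: "cesaro_number \<gamma> 0 = 1" for \<gamma> by (simp add: cesaro_number_def)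
  have wpos: "cesaro_number \<gamma> n > 0" if "\<gamma> > -1" for \<gamma> n
  proof (induction n)
    case (Suc n)
    have "1 + \<gamma> / (real n + 1) > 0" using that by (simp add: field_simps)
    then show ?case using Suc by (simp add: cesaro_number_Suc)
  qed (simp add: w0)
  have M: "M \<ge> 0" using bound[of 0] by (simp add: w0)
  have wmono: "?w n \<le> ?w m" if "n \<le> m" for n m
    using that by (rule lift_Suc_mono_le[rotated]) (use wpos[of \<delta>] \<delta> in \<open>auto simp: cesaro_number_Suc field_simps less_imp_le\<close>)
  have "\<bar>a N\<bar> \<le> 4 * (M * ?w N)"
  proof (rule kaluza_inversion[where d = ?d and w = ?w])
    show "decseq ?d"
      by (rule decseq_SucI) (use wpos[of "\<delta> - 1"] \<delta> in \<open>auto simp: cesaro_number_Suc field_simps\<close>)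
    show "(?d (Suc n))\<^sup>2 \<le> ?d n * ?d (Suc (Suc n))" for n
    proof -
      have "(?d n)\<^sup>2 * (1 + (\<delta> - 1) / (real n + 1)) * (1 + (\<delta> - 1) / (real n + 1)) \<le>
            (?d n)\<^sup>2 * (1 + (\<delta> - 1) / (real n + 1)) * (1 + (\<delta> - 1) / (real (Suc n) + 1))"
        using \<delta> by (intro mult_left_mono) (auto simp: field_simps)
      then show ?thesis by (simp only: cesaro_number_Suc power2_eq_square mult_ac)
    qed
    show "?d n > 0" for n using wpos[of "\<delta> - 1"] \<delta> by simp
    show "?w n = (\<Sum>k\<le>n. ?d k)" for n
      using gbinomial_parallel_sum[of "\<delta> - 1" n] by (simp add: cesaro_number_def algebra_simps)
    fix n assume n: "n \<le> N"
    have "(\<Sum>k\<le>n. ?w (n - k) * a k) = ?w n * (\<Sum>k\<le>n. ?w (n - k) / ?w n * a k)"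
      unfolding sum_distrib_left using wpos[of \<delta> n] \<delta> by (intro sum.cong) auto
    then have "\<bar>\<Sum>k\<le>n. ?w (n - k) * a k\<bar> \<le> ?w n * M"
      using bound[of n] wpos[of \<delta> n] \<delta> by (simp add: abs_mult)
    also have "\<dots> \<le> ?w N * M" using n M by (intro mult_right_mono wmono)
    finally show "\<bar>\<Sum>k\<le>n. ?w (n - k) * a k\<bar> \<le> M * ?w N" by (simp add: mult.commute)
  qed (simp add: w0)
  also have "\<dots> \<le> 4 * (M * (2 * (real N + 1) powr \<delta>))"
    using M cesaro_number_le[OF \<delta>] by (intro mult_left_mono) auto
  finally show ?thesis by simp
qed

section \<open>The Laguerre differential equation\<close>

text \<open>Here \<open>\<alpha> + k + 1\<close> is the upper argument minus \<open>m\<close>, so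
  this is the absorption identity. It relates neighbouring Laguerre coefficients, both for the
  differential equation and for the decay of the terms near the origin.\<close>

lemma laguerre_gbinomial_absorb:
  assumes "n = Suc (k + m)"
  shows "(\<alpha> + real k + 1) * ((real n + \<alpha>) gchoose m) = real (Suc m) * ((real n + \<alpha>) gchoose Suc m)"
  using gbinomial_mult_1[of "real n + \<alpha>" m] assms by (simp add: ring_distribs)

text \<open>Comparing coefficients, the equation amounts to the two-term recurrence
  \<open>rec\<close>.\<close>

lemma laguerre_poly_ode:
  "x * poly (pderiv (pderiv (laguerre_poly \<alpha> n))) x
     + (\<alpha> + 1 - x) * poly (pderiv (laguerre_poly \<alpha> n)) x + real n * poly (laguerre_poly \<alpha> n) x = 0"
proof -
  let ?P = "laguerre_poly \<alpha> n"
  have rec: "(real k + 1) * (real k + 1 + \<alpha>) * coeff ?P (Suc k) = (real k - real n) * coeff ?P k" for k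
  proof (cases "k < n")
    case True
    then obtain m where m: "n = Suc (k + m)" using less_iff_Suc_add by auto
    have c0: "coeff ?P k = ((real n + \<alpha>) gchoose Suc m) * ((-1) ^ k / fact k)"
      using m by (simp add: coeff_laguerre_poly Suc_diff_le)
    have c1: "(real k + 1) * coeff ?P (Suc k) = - (((real n + \<alpha>) gchoose m) * ((-1) ^ k / fact k))"
    proof -
      have "(real k + 1) * (G * (-1) ^ Suc k / ((real k + 1) * fact k)) = - (G * ((-1) ^ k / fact k))" for G :: real
        by (simp add: divide_simps)
      then show ?thesis using m by (simp add: coeff_laguerre_poly add.commute)
    qed
    have "(real k + 1) * (real k + 1 + \<alpha>) * coeff ?P (Suc k) =
        (\<alpha> + real k + 1) * ((real k + 1) * coeff ?P (Suc k))" by simp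
    also have "\<dots> = - ((\<alpha> + real k + 1) * ((real n + \<alpha>) gchoose m)) * ((-1) ^ k / fact k)"
      unfolding c1 by simp
    also have "\<dots> = (real k - real n) * coeff ?P k"
    proof -
      have "real k - real n = - real (Suc m)" using m by simp
      then show ?thesis unfolding laguerre_gbinomial_absorb[OF m] c0 by (simp only: mult_minus_left mult.assoc)
    qed
    finally show ?thesis .
  qed (auto simp: coeff_laguerre_poly)
  have "pCons 0 (pderiv (pderiv ?P)) + smult (\<alpha> + 1) (pderiv ?P) - pCons 0 (pderiv ?P) + smult (real n) ?P = 0"
    (is "?q = 0")
  proof (rule poly_eqI)
    fix k
    have "coeff ?q k = (real k + 1) * (real k + 1 + \<alpha>) * coeff ?P (Suc k) - (real k - real n) * coeff ?P k"
      by (cases k) (simp_all add: coeff_pderiv algebra_simps)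
    then show "coeff ?q k = coeff 0 k" using rec[of k] by simp
  qed
  then have "poly ?q x = 0" by simp
  then show ?thesis by (simp add: algebra_simps)
qed

text \<open>\<open>lag_osc \<alpha> n s = sqrt s * laguerre_fun \<alpha> n (s\<^sup>2)\<close>: in this variable the equation has no
  first-order term and its frequency is nearly constant.\<close>

definition lag_osc :: "real \<Rightarrow> nat \<Rightarrow> real \<Rightarrow> real" where
  "lag_osc \<alpha> n s = sqrt (Gamma (real n + 1) / Gamma (real n + \<alpha> + 1)) * exp (- s\<^sup>2 / 2) *
     s powr (\<alpha> + 1 / 2) * poly (laguerre_poly \<alpha> n) (s\<^sup>2)"

definition lag_osc' :: "real \<Rightarrow> nat \<Rightarrow> real \<Rightarrow> real" where
  "lag_osc' \<alpha> n s = sqrt (Gamma (real n + 1) / Gamma (real n + \<alpha> + 1)) * exp (- s\<^sup>2 / 2) *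
     s powr (\<alpha> + 1 / 2) * (((\<alpha> + 1 / 2) / s - s) * poly (laguerre_poly \<alpha> n) (s\<^sup>2)
       + 2 * s * poly (pderiv (laguerre_poly \<alpha> n)) (s\<^sup>2))"

lemma lag_osc_sqrt:
  assumes "x > 0"
  shows "lag_osc \<alpha> n (sqrt x) = x powr (1 / 4) * laguerre_fun \<alpha> n x"
proof -
  have "sqrt x powr (\<alpha> + 1 / 2) = x powr (1 / 4) * x powr (\<alpha> / 2)"
    using assms by (simp add: powr_half_sqrt[symmetric] powr_powr add_divide_distrib add.commute flip: powr_add)
  then show ?thesis using assms by (simp add: lag_osc_def laguerre_fun_def)
qed

lemma has_derivative_weight:
  fixes s :: real
  assumes "s > 0"
  shows "((\<lambda>s. C * exp (- s\<^sup>2 / 2) * s powr b) has_real_derivative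
      C * exp (- s\<^sup>2 / 2) * s powr b * (b / s - s)) (at s)"
  using assms
  by (auto intro!: derivative_eq_intros simp: powr_diff field_simps)

lemma DERIV_lag_osc:
  assumes "s > 0"
  shows "(lag_osc \<alpha> n has_real_derivative lag_osc' \<alpha> n s) (at s)"
proof -
  let ?P = "laguerre_poly \<alpha> n"
  have "((\<lambda>s. poly ?P (s\<^sup>2)) has_real_derivative poly (pderiv ?P) (s\<^sup>2) * (2 * s)) (at s)"
    by (rule DERIV_chain2[OF poly_DERIV]) (auto intro!: derivative_eq_intros)
  from DERIV_mult[OF has_derivative_weight[OF assms] this] show ?thesis
    unfolding lag_osc_def[abs_def] lag_osc'_def by (rule back_subst) (simp add: algebra_simps)
qed

lemma DERIV_lag_osc':
  assumes "s > 0"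
  shows "(lag_osc' \<alpha> n has_real_derivative
           - ((4 * real n + 2 * \<alpha> + 2 - s\<^sup>2 + (1 / 4 - \<alpha>\<^sup>2) / s\<^sup>2) * lag_osc \<alpha> n s)) (at s)"
proof -
  let ?P = "laguerre_poly \<alpha> n"
  let ?P1 = "pderiv ?P"
  let ?b = "\<alpha> + 1 / 2"
  let ?W = "sqrt (Gamma (real n + 1) / Gamma (real n + \<alpha> + 1)) * exp (- s\<^sup>2 / 2) * s powr ?b"
  define p0 p1 p2 where "p0 = poly ?P (s\<^sup>2)" and "p1 = poly ?P1 (s\<^sup>2)" and "p2 = poly (pderiv ?P1) (s\<^sup>2)"
  have ode: "s\<^sup>2 * p2 = - (\<alpha> + 1 - s\<^sup>2) * p1 - n * p0"
    using laguerre_poly_ode[of "s\<^sup>2" \<alpha> n] by (simp add: p0_def p1_def p2_def algebra_simps)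
  have sq: "((\<lambda>s. poly q (s\<^sup>2)) has_real_derivative poly (pderiv q) (s\<^sup>2) * (2 * s)) (at s)" for q
    by (rule DERIV_chain2[OF poly_DERIV]) (auto intro!: derivative_eq_intros)
  have D: "((\<lambda>s. (?b / s - s) * poly ?P (s\<^sup>2) + 2 * s * poly ?P1 (s\<^sup>2)) has_real_derivative
     (- ?b / s\<^sup>2 - 1) * p0 + (?b / s - s) * (p1 * (2 * s)) + (2 * p1 + 2 * s * (p2 * (2 * s)))) (at s)"
    unfolding p0_def p1_def p2_def
    using assms by (auto intro!: derivative_eq_intros sq simp: power2_eq_square)
  define W where "W = ?W"
  have "W * (?b / s - s) * ((?b / s - s) * p0 + 2 * s * p1) +
      ((- ?b / s\<^sup>2 - 1) * p0 + (?b / s - s) * (p1 * (2 * s)) + (2 * p1 + 2 * s * (p2 * (2 * s)))) * W =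
      W * ((- ?b / s\<^sup>2 - 1 + (?b / s - s)\<^sup>2) * p0 + (4 * s * (?b / s - s) + 2) * p1 + 4 * (s\<^sup>2 * p2))"
    by (simp add: power2_eq_square algebra_simps)
  \<comment> \<open>After substituting the Laguerre equation, the coefficient
    \<open>4 * s * (?b / s - s) + 2\<close> of \<open>p1\<close> cancels against
    \<open>4 * (\<alpha> + 1 - s^2)\<close> exactly because
    \<open>?b = \<alpha> + 1 / 2\<close>.\<close>
  also have "\<dots> = W * ((- ?b / s\<^sup>2 - 1 + (?b / s - s)\<^sup>2 - 4 * n) * p0)"
    unfolding ode using assms by (simp add: power2_eq_square field_simps)
  also have "- ?b / s\<^sup>2 - 1 + (?b / s - s)\<^sup>2 - 4 * n = - (4 * real n + 2 * \<alpha> + 2 - s\<^sup>2 + (1 / 4 - \<alpha>\<^sup>2) / s\<^sup>2)"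
    using assms by (simp add: power2_eq_square field_simps)
  also have "W * (- (4 * real n + 2 * \<alpha> + 2 - s\<^sup>2 + (1 / 4 - \<alpha>\<^sup>2) / s\<^sup>2) * p0) =
      - ((4 * real n + 2 * \<alpha> + 2 - s\<^sup>2 + (1 / 4 - \<alpha>\<^sup>2) / s\<^sup>2) * lag_osc \<alpha> n s)"
    by (simp only: lag_osc_def W_def p0_def mult_minus_left mult_minus_right mult_ac)
  finally show ?thesis
    unfolding lag_osc'_def[abs_def] W_def p0_def p1_def
    by (rule DERIV_cong[OF DERIV_mult[OF has_derivative_weight[OF assms] D[unfolded p0_def p1_def]]])
qed

section \<open>Energy estimates\<close>

text \<open>The summand \<open>(1/4 - \<alpha>\<^sup>2) / s\<^sup>2\<close> of the potential is left out: for \<open>\<alpha> > 1/2\<close> it is negative and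
  would destroy positivity near the left endpoint \<open>s ~ 1 / sqrt n\<close>.\<close>

definition lag_energy :: "real \<Rightarrow> nat \<Rightarrow> real \<Rightarrow> real" where
  "lag_energy \<alpha> n s =
     (4 * real n + 2 * \<alpha> + 2 - s\<^sup>2) * (lag_osc \<alpha> n s)\<^sup>2 + (lag_osc' \<alpha> n s)\<^sup>2"

lemma DERIV_lag_energy:
  assumes "s > 0"
  shows "(lag_energy \<alpha> n has_real_derivative
           - 2 * s * (lag_osc \<alpha> n s)\<^sup>2 - 2 * ((1 / 4 - \<alpha>\<^sup>2) / s\<^sup>2) * lag_osc \<alpha> n s * lag_osc' \<alpha> n s) (at s)"
  unfolding lag_energy_def[abs_def]
  by (rule derivative_eq_intros DERIV_lag_osc DERIV_lag_osc' assms refl)+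
     (simp add: power2_eq_square algebra_simps)

text \<open>Gronwall's argument in both directions: the energy satisfies
  \<open>\<bar>E'\<bar> \<le> \<phi> * E\<close>, and \<open>\<Phi>\<close> is an antiderivative of
  \<open>\<phi>\<close>. Its first term comes from the slow change of the potential, its second from
  the omitted singular summand.\<close>

lemma lag_energy_exp_mono:
  assumes \<alpha>: "\<alpha> > -1/2" and n: "n \<ge> 1" and st: "0 < s" "s \<le> t" "t \<le> sqrt (real n)"
  defines "\<Phi> \<equiv> \<lambda>s. s\<^sup>2 / (3 * real n) - \<bar>1 / 4 - \<alpha>\<^sup>2\<bar> / (s * sqrt (3 * real n))"
  shows "lag_energy \<alpha> n s * exp (\<Phi> s) \<le> lag_energy \<alpha> n t * exp (\<Phi> t)"
    and "lag_energy \<alpha> n t * exp (- \<Phi> t) \<le> lag_energy \<alpha> n s * exp (- \<Phi> s)"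
proof -
  define \<phi> where "\<phi> u = 2 * u / (3 * real n) + \<bar>1 / 4 - \<alpha>\<^sup>2\<bar> / (u\<^sup>2 * sqrt (3 * real n))" for u
  define E' where "E' u = - 2 * u * (lag_osc \<alpha> n u)\<^sup>2
     - 2 * ((1 / 4 - \<alpha>\<^sup>2) / u\<^sup>2) * lag_osc \<alpha> n u * lag_osc' \<alpha> n u" for u
  have D: "(\<Phi> has_real_derivative \<phi> u) (at u)" if "u > 0" for u
    unfolding \<Phi>_def \<phi>_def using that n
    by (auto intro!: derivative_eq_intros simp: power2_eq_square field_simps)
  have DE: "(lag_energy \<alpha> n has_real_derivative E' u) (at u)" if "u > 0" for u
    unfolding E'_def by (rule DERIV_lag_energy) fact
  have bound: "\<bar>E' u\<bar> \<le> \<phi> u * lag_energy \<alpha> n u" if u: "0 < u" "u \<le> sqrt (real n)" for u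
  proof -
    define v v' where "v = lag_osc \<alpha> n u" and "v' = lag_osc' \<alpha> n u"
    have u2: "u\<^sup>2 \<le> real n" using power_mono[OF u(2), of 2] u(1) by simp
    then have Q: "3 * real n * v\<^sup>2 \<le> (4 * real n + 2 * \<alpha> + 2 - u\<^sup>2) * v\<^sup>2"
      using \<alpha> by (intro mult_right_mono) auto
    have E: "lag_energy \<alpha> n u = (4 * real n + 2 * \<alpha> + 2 - u\<^sup>2) * v\<^sup>2 + v'\<^sup>2"
      by (simp add: lag_energy_def v_def v'_def)
    have 1: "v\<^sup>2 \<le> lag_energy \<alpha> n u / (3 * real n)"
      using Q n unfolding E by (simp add: field_simps add_increasing)
    let ?r = "sqrt (3 * real n)"
    \<comment> \<open>The arithmetic-geometric mean inequality bounds the mixed product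
      \<open>v * v'\<close> by the energy with a gain of order \<open>sqrt n\<close>.\<close>
    have "0 \<le> (?r * \<bar>v\<bar> - \<bar>v'\<bar>)\<^sup>2" by simp
    also have "\<dots> = 3 * real n * v\<^sup>2 + v'\<^sup>2 - ?r * (2 * \<bar>v * v'\<bar>)"
      by (simp add: power2_diff power_mult_distrib abs_mult algebra_simps)
    finally have "?r * (2 * \<bar>v * v'\<bar>) \<le> lag_energy \<alpha> n u" using Q unfolding E by linarith
    then have 2: "2 * \<bar>v * v'\<bar> \<le> lag_energy \<alpha> n u / ?r"
      using n by (simp add: pos_le_divide_eq mult.commute)
    have *: "\<bar>2 * (k / u\<^sup>2) * v * v'\<bar> = \<bar>k\<bar> / u\<^sup>2 * (2 * \<bar>v * v'\<bar>)" for k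
      by (simp add: abs_mult)
    have "\<bar>E' u\<bar> \<le> 2 * u * v\<^sup>2 + \<bar>1 / 4 - \<alpha>\<^sup>2\<bar> / u\<^sup>2 * (2 * \<bar>v * v'\<bar>)"
      unfolding E'_def v_def[symmetric] v'_def[symmetric] using u(1)
      by (intro order.trans[OF abs_triangle_ineq4]) (simp only: *, simp add: abs_mult)
    also have "\<dots> \<le> 2 * u * (lag_energy \<alpha> n u / (3 * real n))
        + \<bar>1 / 4 - \<alpha>\<^sup>2\<bar> / u\<^sup>2 * (lag_energy \<alpha> n u / ?r)"
      using u(1) 1 2 by (intro add_mono mult_left_mono) auto
    also have "\<dots> = \<phi> u * lag_energy \<alpha> n u" by (simp add: \<phi>_def algebra_simps)
    finally show ?thesis .
  qed
  show "lag_energy \<alpha> n s * exp (\<Phi> s) \<le> lag_energy \<alpha> n t * exp (\<Phi> t)"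
  proof (rule DERIV_nonneg_imp_nondecreasing[OF st(2)])
    fix u assume u: "s \<le> u" "u \<le> t"
    have "((\<lambda>u. lag_energy \<alpha> n u * exp (\<Phi> u)) has_real_derivative
            (E' u + \<phi> u * lag_energy \<alpha> n u) * exp (\<Phi> u)) (at u)"
      using u st by (auto intro!: derivative_eq_intros D DE simp: algebra_simps)
    moreover have "0 \<le> (E' u + \<phi> u * lag_energy \<alpha> n u) * exp (\<Phi> u)"
      using bound[of u] u st by (intro mult_nonneg_nonneg) auto
    ultimately show "\<exists>y. ((\<lambda>u. lag_energy \<alpha> n u * exp (\<Phi> u)) has_real_derivative y) (at u) \<and> 0 \<le> y"
      by blast
  qed
  show "lag_energy \<alpha> n t * exp (- \<Phi> t) \<le> lag_energy \<alpha> n s * exp (- \<Phi> s)"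
  proof (rule DERIV_nonpos_imp_nonincreasing[OF st(2)])
    fix u assume u: "s \<le> u" "u \<le> t"
    have "((\<lambda>u. lag_energy \<alpha> n u * exp (- \<Phi> u)) has_real_derivative
            (E' u - \<phi> u * lag_energy \<alpha> n u) * exp (- \<Phi> u)) (at u)"
      using u st by (auto intro!: derivative_eq_intros D DE simp: algebra_simps)
    moreover have "(E' u - \<phi> u * lag_energy \<alpha> n u) * exp (- \<Phi> u) \<le> 0"
      using bound[of u] u st by (intro mult_nonpos_nonneg) auto
    ultimately show "\<exists>y. ((\<lambda>u. lag_energy \<alpha> n u * exp (- \<Phi> u)) has_real_derivative y) (at u) \<and> y \<le> 0"
      by blast
  qed
qed

lemma lag_energy_lower:
  assumes "\<alpha> > -1/2" "0 \<le> s" "s \<le> sqrt (real n)"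
  shows "3 * real n * (lag_osc \<alpha> n s)\<^sup>2 + (lag_osc' \<alpha> n s)\<^sup>2 \<le> lag_energy \<alpha> n s"
proof -
  have "s\<^sup>2 \<le> real n" using power_mono[OF assms(3,2), of 2] by simp
  then show ?thesis
    unfolding lag_energy_def using assms by (intro add_right_mono mult_right_mono) auto
qed

lemma lag_energy_nonneg:
  assumes "\<alpha> > -1/2" "0 \<le> s" "s \<le> sqrt (real n)"
  shows "0 \<le> lag_energy \<alpha> n s"
proof -
  have "0 \<le> 3 * real n * (lag_osc \<alpha> n s)\<^sup>2 + (lag_osc' \<alpha> n s)\<^sup>2" by simp
  then show ?thesis using lag_energy_lower[OF assms] by linarith
qed

text \<open>The exponent \<open>\<Phi>\<close> changes by a bounded amount. Its growing term is at
  most 1/3 up to \<open>sqrt n\<close>, and at the left endpoint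
  \<open>?s0 * sqrt (3 * n) = sqrt (3 * c)\<close>, so the singular term is bounded independently of
  \<open>n\<close>.\<close>

lemma lag_energy_comparable:
  assumes \<alpha>: "\<alpha> > -1/2" and c: "c > 0"
  obtains \<Lambda> where "\<Lambda> \<ge> 1"
    and "\<And>n s. \<lbrakk>n \<ge> 1; sqrt (c / real n) \<le> s; s \<le> sqrt (real n)\<rbrakk> \<Longrightarrow>
           lag_energy \<alpha> n s \<le> \<Lambda> * lag_energy \<alpha> n (sqrt (c / real n)) \<and>
           lag_energy \<alpha> n (sqrt (c / real n)) \<le> \<Lambda> * lag_energy \<alpha> n s"
proof
  let ?k = "\<bar>1 / 4 - \<alpha>\<^sup>2\<bar>"
  define \<Lambda> where "\<Lambda> = exp (1 / 3 + ?k / sqrt (3 * c))"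
  show "\<Lambda> \<ge> 1" using c by (simp add: \<Lambda>_def)
  fix n :: nat and s :: real
  assume n: "n \<ge> 1" and s: "sqrt (c / real n) \<le> s" "s \<le> sqrt (real n)"
  let ?s0 = "sqrt (c / real n)"
  define \<Phi> where "\<Phi> s = s\<^sup>2 / (3 * real n) - ?k / (s * sqrt (3 * real n))" for s
  have s0: "?s0 > 0" using c n by simp
  have "?s0 * sqrt (3 * real n) = sqrt (3 * c)"
    using n c by (simp flip: real_sqrt_mult)
  then have 1: "- \<Phi> ?s0 \<le> ?k / sqrt (3 * c)"
    unfolding \<Phi>_def by (simp add: add_increasing)
  have "s\<^sup>2 \<le> real n" using power_mono[OF s(2), of 2] s(1) s0 by simp
  then have "s\<^sup>2 / (3 * real n) \<le> 1 / 3" using n by (simp add: field_simps)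
  moreover have "s \<ge> 0" using s s0 by linarith
  then have "0 \<le> ?k / (s * sqrt (3 * real n))" by simp
  ultimately have 2: "\<Phi> s \<le> 1 / 3" unfolding \<Phi>_def by linarith
  have L: "exp (\<Phi> s - \<Phi> ?s0) \<le> \<Lambda>" unfolding \<Lambda>_def using 1 2 by simp
  have E: "lag_energy \<alpha> n s \<ge> 0" "lag_energy \<alpha> n ?s0 \<ge> 0"
    using s s0 by (intro lag_energy_nonneg[OF \<alpha>]; linarith)+
  note mono = lag_energy_exp_mono[OF \<alpha> n s0 s(1) s(2), folded \<Phi>_def]
  have "lag_energy \<alpha> n s \<le> lag_energy \<alpha> n ?s0 * exp (\<Phi> s - \<Phi> ?s0)"
    using mono(2) by (simp add: exp_diff exp_minus field_simps)
  also have "\<dots> \<le> lag_energy \<alpha> n ?s0 * \<Lambda>" using L E by (intro mult_left_mono)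
  finally have *: "lag_energy \<alpha> n s \<le> \<Lambda> * lag_energy \<alpha> n ?s0" by (simp add: mult.commute)
  have "lag_energy \<alpha> n ?s0 \<le> lag_energy \<alpha> n s * exp (\<Phi> s - \<Phi> ?s0)"
    using mono(1) by (simp add: exp_diff field_simps)
  also have "\<dots> \<le> lag_energy \<alpha> n s * \<Lambda>" using L E by (intro mult_left_mono)
  finally show "lag_energy \<alpha> n s \<le> \<Lambda> * lag_energy \<alpha> n ?s0 \<and> lag_energy \<alpha> n ?s0 \<le> \<Lambda> * lag_energy \<alpha> n s"
    using * by (simp add: mult.commute)
qed

section \<open>Lower bound for the energy near the origin\<close>

text \<open>For such small \<open>x\<close> each term of the explicit sum is at most a quarter of
  the preceding one in absolute value, so the geometric tail cannot cancel more than half of the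
  constant term.\<close>

lemma laguerre_poly_ge_half:
  assumes \<alpha>: "\<alpha> > -1" and x: "0 \<le> x" "real n * x \<le> (\<alpha> + 1) / 4"
  shows "poly (laguerre_poly \<alpha> n) x \<ge> ((real n + \<alpha>) gchoose n) / 2"
proof -
  define t where "t k = ((real n + \<alpha>) gchoose (n - k)) * x ^ k / fact k" for k
  have t0: "t k \<ge> 0" if "k \<le> n" for k
  proof -
    have "((real n + \<alpha>) gchoose (n - k)) = pochhammer (\<alpha> + real k + 1) (n - k) / fact (n - k)"
      using that by (simp add: gbinomial_pochhammer' of_nat_diff algebra_simps)
    moreover have "pochhammer (\<alpha> + real k + 1) (n - k) > 0"
      using \<alpha> by (intro pochhammer_pos) auto
    ultimately show ?thesis using x by (simp add: t_def)
  qed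
  have step: "t (Suc k) \<le> t k / 4" if k: "Suc k \<le> n" for k
  proof -
    obtain m where m: "n = Suc (k + m)" using k less_iff_Suc_add by (metis Suc_le_lessD add_Suc_right)
    have "(\<alpha> + real k + 1) * (real k + 1) * t (Suc k) =
        (\<alpha> + real k + 1) * ((real n + \<alpha>) gchoose m) * (x * x ^ k / fact k)"
    proof -
      have "c * (real k + 1) * (G * x ^ Suc k / ((real k + 1) * fact k)) = c * G * (x * x ^ k / fact k)" for c G :: real
        by (simp add: divide_simps)
      then show ?thesis using m by (simp add: t_def add.commute)
    qed
    also have "\<dots> = real (Suc m) * x * t k"
      unfolding laguerre_gbinomial_absorb[OF m] using m by (simp add: t_def Suc_diff_le)
    also have "\<dots> \<le> (\<alpha> + 1) / 4 * t k"
      using x m t0[of k] k mult_right_mono[of "real (Suc m)" "real n" x] by (intro mult_right_mono) auto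
    also have "\<dots> \<le> (\<alpha> + real k + 1) * (real k + 1) / 4 * t k"
    proof -
      have "(\<alpha> + 1) * 1 \<le> (\<alpha> + real k + 1) * (real k + 1)" using \<alpha> by (intro mult_mono) auto
      then show ?thesis using t0[of k] k by (intro mult_right_mono divide_right_mono) auto
    qed
    finally have "(\<alpha> + real k + 1) * (real k + 1) * t (Suc k) \<le> (\<alpha> + real k + 1) * (real k + 1) * (t k / 4)"
      by simp
    moreover have "(\<alpha> + real k + 1) * (real k + 1) > 0" using \<alpha> by simp
    ultimately show ?thesis by (rule mult_left_le_imp_le)
  qed
  have geo: "t k \<le> t 0 * (1 / 4) ^ k" if "k \<le> n" for k
    using that
  proof (induction k)
    case (Suc k)
    then show ?case using step[of k] by simp
  qed simp
  have "(\<Sum>k\<in>{1..n}. (1 / 4 :: real) ^ k) \<le> 1 / 3"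
  proof (cases "n = 0")
    case False
    then have "(\<Sum>k\<in>{1..n}. (1 / 4 :: real) ^ k) = ((1 / 4) ^ 1 - (1 / 4) ^ Suc n) / (1 - 1 / 4)"
      by (subst sum_gp) auto
    also have "\<dots> \<le> 1 / 3" by simp
    finally show ?thesis .
  qed simp
  have "(\<Sum>k\<in>{1..n}. t k) \<le> t 0 * (\<Sum>k\<in>{1..n}. (1 / 4) ^ k)"
    unfolding sum_distrib_left by (intro sum_mono geo) auto
  also have "\<dots> \<le> t 0 * (1 / 3)" by (rule mult_left_mono[OF _ t0]) (fact, simp)
  finally have tail: "(\<Sum>k\<in>{1..n}. t k) \<le> t 0 / 2" using t0[of 0] by simp
  have "poly (laguerre_poly \<alpha> n) x = (\<Sum>k\<le>n. (-1) ^ k * t k)"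
    unfolding poly_laguerre_poly t_def by (intro sum.cong) (auto simp: power_minus[of x])
  also have "\<dots> = t 0 + (\<Sum>k\<in>{1..n}. (-1) ^ k * t k)"
    by (subst atMost_atLeast0, subst sum.atLeast_Suc_atMost) auto
  also have "\<dots> \<ge> t 0 + (\<Sum>k\<in>{1..n}. - t k)"
  proof (intro add_left_mono sum_mono)
    fix k assume "k \<in> {1..n}"
    then show "- t k \<le> (-1) ^ k * t k" using t0[of k] by (cases "even k") auto
  qed
  also have "t 0 + (\<Sum>k\<in>{1..n}. - t k) = t 0 - (\<Sum>k\<in>{1..n}. t k)" by (simp add: sum_negf)
  finally show ?thesis using tail by (simp add: t_def)
qed

lemma Gamma_ratio_ge:
  fixes \<alpha> :: real
  assumes \<alpha>: "\<alpha> > -1"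
  shows "eventually (\<lambda>n. real n powr \<alpha> / 2 \<le> Gamma (real n + \<alpha> + 1) / fact n) sequentially"
proof -
  \<comment> \<open>The series uses a Pochhammer symbol with one factor too many and the power
    \<open>\<alpha> + 1\<close> of \<open>n\<close>; the quotient
    \<open>n / (n + (\<alpha> + 1))\<close> removes both.\<close>
  have "(\<lambda>n. rGamma_series (\<alpha> + 1) n * Gamma (\<alpha> + 1) * (real n / (real n + (\<alpha> + 1)))) \<longlonglongrightarrow>
        rGamma (\<alpha> + 1) * Gamma (\<alpha> + 1) * 1"
  proof (intro tendsto_intros)
    show "(\<lambda>n. real n / (real n + (\<alpha> + 1))) \<longlonglongrightarrow> 1" by real_asymp
  qed
  moreover have "rGamma (\<alpha> + 1) * Gamma (\<alpha> + 1) = 1"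
  proof -
    have "Gamma (\<alpha> + 1) > 0" using \<alpha> by (intro Gamma_real_pos) simp
    then show ?thesis by (simp add: rGamma_inverse_Gamma)
  qed
  ultimately have "eventually (\<lambda>n. rGamma_series (\<alpha> + 1) n * Gamma (\<alpha> + 1) * (real n / (real n + (\<alpha> + 1))) > 1 / 2) sequentially"
    by (intro order_tendstoD(1)) auto
  then show ?thesis
    using eventually_gt_at_top[of 0]
  proof eventually_elim
    case (elim n)
    have nz: "\<alpha> + 1 \<notin> \<int>\<^sub>\<le>\<^sub>0" using \<alpha> by (auto elim!: nonpos_Ints_cases)
    have "Gamma (\<alpha> + 1) > 0" using \<alpha> by (intro Gamma_real_pos) simp
    then have "Gamma (real n + \<alpha> + 1) = pochhammer (\<alpha> + 1) n * Gamma (\<alpha> + 1)"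
      using pochhammer_Gamma[OF nz, of n] by (simp add: add_ac)
    moreover have "rGamma_series (\<alpha> + 1) n =
        pochhammer (\<alpha> + 1) n * (real n + (\<alpha> + 1)) / (fact n * (real n powr \<alpha> * real n))"
      using elim by (simp add: rGamma_series_def pochhammer_Suc powr_def exp_add distrib_right add_ac)
    moreover have "real n + (\<alpha> + 1) > 0" "real n > 0" using elim \<alpha> by auto
    ultimately have "rGamma_series (\<alpha> + 1) n * Gamma (\<alpha> + 1) * (real n / (real n + (\<alpha> + 1))) =
        Gamma (real n + \<alpha> + 1) / fact n / real n powr \<alpha>"
      by simp
    then have "1 / 2 < Gamma (real n + \<alpha> + 1) / fact n / real n powr \<alpha>" using elim(1) by argo
    then show ?case using \<open>real n > 0\<close> by (subst (asm) less_divide_eq) (auto simp: less_imp_le)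
  qed
qed

text \<open>With \<open>R = Gamma (n + \<alpha> + 1) / n!\<close>, the squared normalization is
  \<open>1 / R\<close> and the polynomial at \<open>x = c / n\<close> is at least
  \<open>R / (2 * Gamma (\<alpha> + 1))\<close>. Since \<open>R\<close> is at least of order
  \<open>n powr \<alpha>\<close>, the powers cancel against \<open>x powr \<alpha>\<close>, and
  \<open>n * sqrt x\<close> leaves the order \<open>sqrt n\<close>.\<close>

lemma lag_energy_ge:
  assumes \<alpha>: "\<alpha> > -1/2"
  defines "c \<equiv> (\<alpha> + 1) / 4"
  obtains \<kappa> where "\<kappa> > 0"
    and "eventually (\<lambda>n. lag_energy \<alpha> n (sqrt (c / real n)) \<ge> \<kappa> * sqrt (real n)) sequentially"
proof
  let ?G = "Gamma (\<alpha> + 1)"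
  have c: "c > 0" using \<alpha> by (simp add: c_def)
  have G: "?G > 0" using \<alpha> by (intro Gamma_real_pos) auto
  \<comment> \<open>The 3 is the coefficient of \<open>n * v^2\<close> in the energy bound; the 8
    combines the square of the one half in the polynomial bound with the one half in the bound for
    \<open>R\<close>.\<close>
  define \<kappa> where "\<kappa> = 3 * (sqrt c * exp (- c) * c powr \<alpha> / (8 * ?G\<^sup>2))"
  show "\<kappa> > 0" using c G by (simp add: \<kappa>_def)
  have "eventually (\<lambda>n. real n > c) sequentially" by real_asymp
  moreover have "\<alpha> > -1" using \<alpha> by simp
  note Gamma_ratio_ge[OF this] eventually_gt_at_top[of "0::nat"]
  ultimately
  show "eventually (\<lambda>n. lag_energy \<alpha> n (sqrt (c / real n)) \<ge> \<kappa> * sqrt (real n)) sequentially"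
  proof eventually_elim
    case (elim n)
    then have n: "real n > 0" "n \<ge> 1" by auto
    define x where "x = c / real n"
    have x: "x > 0" "x \<le> c" "real n * x = c" using c n by (auto simp: x_def field_simps)
    define R where "R = Gamma (real n + \<alpha> + 1) / fact n"
    have Rge: "real n powr \<alpha> / 2 \<le> R" using elim by (simp add: R_def)
    have R: "R > 0" using Rge n by (smt (verit) powr_gt_zero half_gt_zero)
    have nz: "real n + \<alpha> + 1 \<notin> \<int>\<^sub>\<le>\<^sub>0" using \<alpha> by (auto elim!: nonpos_Ints_cases)
    have "((real n + \<alpha>) gchoose n) = R / ?G"
      using nz by (subst gbinomial_Gamma) (auto simp: R_def)
    then have P: "R / ?G / 2 \<le> poly (laguerre_poly \<alpha> n) x"
      using laguerre_poly_ge_half[of \<alpha> x n] \<alpha> x by (simp add: c_def)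
    have "(lag_osc \<alpha> n (sqrt x))\<^sup>2 = inverse R * exp (- x) * (sqrt x * x powr \<alpha>) * (poly (laguerre_poly \<alpha> n) x)\<^sup>2"
    proof -
      have "(sqrt x powr (\<alpha> + 1 / 2))\<^sup>2 = sqrt x * x powr \<alpha>"
        using x by (simp add: powr_half_sqrt[symmetric] powr_powr power2_eq_square flip: powr_add) (simp add: field_simps)
      moreover have "(exp (- x / 2))\<^sup>2 = exp (- x)" by (simp flip: exp_double)
      moreover have "(sqrt (Gamma (real n + 1) / Gamma (real n + \<alpha> + 1)))\<^sup>2 = inverse R"
      proof -
        have "Gamma (real n + 1) = fact n" using Gamma_fact[of n, where 'a=real] by (simp add: add.commute)
        then have "Gamma (real n + 1) / Gamma (real n + \<alpha> + 1) = inverse R" by (simp add: R_def)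
        then show ?thesis using R by simp
      qed
      ultimately show ?thesis using x by (simp add: lag_osc_def power_mult_distrib)
    qed
    also have "\<dots> \<ge> inverse R * exp (- x) * (sqrt x * x powr \<alpha>) * (R / ?G / 2)\<^sup>2"
      using R G x by (intro mult_left_mono power_mono P) auto
    also have "inverse R * exp (- x) * (sqrt x * x powr \<alpha>) * (R / ?G / 2)\<^sup>2 =
        R * x powr \<alpha> * exp (- x) * sqrt x / (4 * ?G\<^sup>2)"
      using R by (simp add: power2_eq_square field_simps)
    also have "\<dots> \<ge> real n powr \<alpha> / 2 * x powr \<alpha> * exp (- c) * sqrt x / (4 * ?G\<^sup>2)"
      using Rge x R by (intro divide_right_mono mult_right_mono mult_mono) auto
    also have "real n powr \<alpha> / 2 * x powr \<alpha> * exp (- c) * sqrt x / (4 * ?G\<^sup>2) =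
        c powr \<alpha> * exp (- c) * sqrt x / (8 * ?G\<^sup>2)"
      unfolding x(3)[symmetric] powr_mult by simp
    finally have v: "c powr \<alpha> * exp (- c) * sqrt x / (8 * ?G\<^sup>2) \<le> (lag_osc \<alpha> n (sqrt x))\<^sup>2" .
    have "x \<le> 1" using elim n by (simp add: x_def)
    then have xn: "sqrt x \<le> sqrt (real n)" using n by (intro real_sqrt_le_mono) linarith
    have "\<kappa> * sqrt (real n) = 3 * real n * (c powr \<alpha> * exp (- c) * sqrt x / (8 * ?G\<^sup>2))"
    proof -
      have "real n * sqrt x = sqrt c * sqrt (real n)"
        using n by (simp add: x_def real_sqrt_divide real_div_sqrt flip: times_divide_eq_left)
      then show ?thesis by (simp add: \<kappa>_def mult_ac)
    qed
    also have "\<dots> \<le> 3 * real n * (lag_osc \<alpha> n (sqrt x))\<^sup>2"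
      using v by (intro mult_left_mono) auto
    also have "\<dots> \<le> lag_energy \<alpha> n (sqrt x)"
    proof -
      have "0 \<le> (lag_osc' \<alpha> n (sqrt x))\<^sup>2" by simp
      moreover have "3 * real n * (lag_osc \<alpha> n (sqrt x))\<^sup>2 + (lag_osc' \<alpha> n (sqrt x))\<^sup>2 \<le> lag_energy \<alpha> n (sqrt x)"
        by (rule lag_energy_lower[OF \<alpha>]) (use xn x in auto)
      ultimately show ?thesis by linarith
    qed
    finally show ?case by (simp add: x_def)
  qed
qed

section \<open>Small values of Laguerre functions\<close>

text \<open>Final arithmetic of the small-value estimate: \<open>F0\<close> of order at least
  \<open>sqrt N\<close> makes \<open>N powr (-1/4) / sqrt F0\<close> at most of order
  \<open>1 / sqrt N\<close>, and \<open>sqrt B * sqrt (N * B)\<close> restores \<open>B\<close>. The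
  condition \<open>c \<le> N * B\<close> absorbs the boundary term into the other one.\<close>

lemma small_ball_scaling:
  fixes \<eta> \<Lambda> \<kappa> B D N F0 :: real
  assumes "\<eta> > 0" "\<Lambda> \<ge> 1" "\<kappa> > 0" "B > 0" "N > 0" "c > 0" "D \<ge> 0" "c \<le> N * B"
    and F0: "\<kappa> * sqrt N \<le> F0"
  shows "8 * (\<eta> * N powr (-1/4)) * sqrt B / (F0 / \<Lambda>) * (4 * sqrt (\<Lambda> * F0) + D * sqrt N * sqrt (\<Lambda> * F0) * sqrt B)
     \<le> 8 * \<Lambda>\<^sup>2 / sqrt \<kappa> * (4 / sqrt c + D) * \<eta> * B"
proof -
  have F0pos: "F0 > 0" using F0 assms by (smt (verit) mult_pos_pos real_sqrt_gt_zero)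
  have L: "sqrt \<Lambda> \<le> \<Lambda>" using assms by (simp add: real_le_lsqrt power2_eq_square)
  have N4: "N powr (-1/4) = 1 / sqrt (sqrt N)"
    using assms by (simp add: powr_half_sqrt[symmetric] powr_powr powr_minus field_simps)
  have q: "sqrt \<kappa> * sqrt (sqrt N) \<le> sqrt F0"
    using F0 by (simp flip: real_sqrt_mult)
  have "8 * (\<eta> * N powr (-1/4)) * sqrt B / (F0 / \<Lambda>) * (4 * sqrt (\<Lambda> * F0) + D * sqrt N * sqrt (\<Lambda> * F0) * sqrt B)
     = 8 * \<eta> * (\<Lambda> * sqrt \<Lambda>) * sqrt B / sqrt (sqrt N) * (sqrt F0 / F0) * (4 + D * sqrt (N * B))"
    using assms F0pos unfolding N4 by (simp add: real_sqrt_mult field_simps)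
  also have "sqrt F0 / F0 = 1 / sqrt F0" using F0pos by (simp add: real_div_sqrt sqrt_divide_self_eq inverse_eq_divide)
  also have "8 * \<eta> * (\<Lambda> * sqrt \<Lambda>) * sqrt B / sqrt (sqrt N) * (1 / sqrt F0) * (4 + D * sqrt (N * B)) \<le>
      8 * \<eta> * \<Lambda>\<^sup>2 * sqrt B / sqrt (sqrt N) * (1 / (sqrt \<kappa> * sqrt (sqrt N))) * ((4 / sqrt c + D) * sqrt (N * B))"
  proof (intro mult_mono divide_right_mono divide_left_mono q)
    show "\<Lambda> * sqrt \<Lambda> \<le> \<Lambda>\<^sup>2" using L assms by (simp add: power2_eq_square)
    have "sqrt c \<le> sqrt (N * B)" using assms by simp
    then have "4 \<le> 4 / sqrt c * sqrt (N * B)" using assms by (simp add: field_simps)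
    then show "4 + D * sqrt (N * B) \<le> (4 / sqrt c + D) * sqrt (N * B)" by (simp add: distrib_right)
  qed (use assms F0pos in auto)
  also have "\<dots> = 8 * \<Lambda>\<^sup>2 / sqrt \<kappa> * (4 / sqrt c + D) * \<eta> * (sqrt B * sqrt (N * B) / (sqrt (sqrt N) * sqrt (sqrt N)))"
    by (simp only: divide_inverse inverse_mult_distrib mult_1 mult_ac)
  also have "sqrt B * sqrt (N * B) / (sqrt (sqrt N) * sqrt (sqrt N)) = B"
    using assms by (simp add: real_sqrt_mult)
  finally show ?thesis .
qed

text \<open>The positive part of this derivative is of size \<open>v'\<^sup>2 / h\<close> on the set \<open>\<bar>v\<bar> \<le> h\<close>, while the
  negative part and the boundary values are bounded independently of \<open>h\<close>; integrating bounds the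
  measure of that set by a multiple of \<open>h\<close>.\<close>

lemma DERIV_osc_flux:
  fixes h x :: real
  assumes "x > 0" "h > 0"
  defines "s \<equiv> sqrt x"
  shows "((\<lambda>x. arctan (lag_osc \<alpha> n (sqrt x) / h) * lag_osc' \<alpha> n (sqrt x)) has_real_derivative
      (h * (lag_osc' \<alpha> n s)\<^sup>2 / (h\<^sup>2 + (lag_osc \<alpha> n s)\<^sup>2) - arctan (lag_osc \<alpha> n s / h) *
        ((4 * real n + 2 * \<alpha> + 2 - s\<^sup>2 + (1 / 4 - \<alpha>\<^sup>2) / s\<^sup>2) * lag_osc \<alpha> n s)) / (2 * s)) (at x)"
proof -
  have s: "s > 0" using assms by (simp add: s_def)
  let ?Q = "4 * real n + 2 * \<alpha> + 2 - s\<^sup>2 + (1 / 4 - \<alpha>\<^sup>2) / s\<^sup>2"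
  define v where "v = lag_osc \<alpha> n s"
  define v' where "v' = lag_osc' \<alpha> n s"
  have sq: "(sqrt has_real_derivative 1 / (2 * s)) (at x)"
    using DERIV_real_sqrt[OF assms(1)] by (simp add: s_def inverse_eq_divide mult.commute)
  have 1: "((\<lambda>x. lag_osc \<alpha> n (sqrt x)) has_real_derivative v' * (1 / (2 * s))) (at x)"
    using DERIV_chain2[OF DERIV_lag_osc[OF s, unfolded s_def] sq] by (simp add: v'_def s_def)
  have 2: "((\<lambda>x. lag_osc' \<alpha> n (sqrt x)) has_real_derivative - (?Q * v) * (1 / (2 * s))) (at x)"
    using DERIV_chain2[OF DERIV_lag_osc'[OF s, unfolded s_def] sq] by (simp add: v_def s_def)
  have hv: "h\<^sup>2 + v\<^sup>2 > 0" using assms(2) by (simp add: add_pos_nonneg)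
  have 3: "((\<lambda>x. arctan (lag_osc \<alpha> n (sqrt x) / h)) has_real_derivative h * v' / (h\<^sup>2 + v\<^sup>2) * (1 / (2 * s))) (at x)"
  proof -
    have "inverse (1 + (v / h)\<^sup>2) * (v' * (1 / (2 * s)) / h) = h * v' / (h\<^sup>2 + v\<^sup>2) * (1 / (2 * s))"
      using hv assms(2) by (simp add: divide_simps power2_eq_square)
    then show ?thesis
      using DERIV_chain2[OF DERIV_arctan DERIV_cdivide[OF 1, of h]] by (simp add: v_def s_def)
  qed
  have "h * v' / d * (1 / (2 * s)) * v' + - (Q * v) * (1 / (2 * s)) * a = (h * v'\<^sup>2 / d - a * (Q * v)) / (2 * s)"
    for d Q a
    by (simp add: power2_eq_square diff_divide_distrib mult_ac)
  then show ?thesis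
    using DERIV_mult[OF 3 2] by (simp only: v_def v'_def s_def)
qed

lemma lag_osc_small_ball:
  assumes \<alpha>: "\<alpha> > -1/2"
  defines "c \<equiv> (\<alpha> + 1) / 4"
  obtains C where "C > 0"
    and "eventually (\<lambda>n. \<forall>\<eta> B. \<eta> > 0 \<longrightarrow> c / real n \<le> B \<longrightarrow> B \<le> real n \<longrightarrow>
           measure lebesgue {x \<in> {c / real n..B}. \<bar>lag_osc \<alpha> n (sqrt x)\<bar> \<le> \<eta> * real n powr (-1/4)} \<le> C * \<eta> * B)
         sequentially"
proof -
  have c: "c > 0" using \<alpha> by (simp add: c_def)
  obtain \<Lambda> where \<Lambda>: "\<Lambda> \<ge> 1"
    and comp: "\<And>n s. \<lbrakk>n \<ge> 1; sqrt (c / real n) \<le> s; s \<le> sqrt (real n)\<rbrakk> \<Longrightarrow>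
           lag_energy \<alpha> n s \<le> \<Lambda> * lag_energy \<alpha> n (sqrt (c / real n)) \<and>
           lag_energy \<alpha> n (sqrt (c / real n)) \<le> \<Lambda> * lag_energy \<alpha> n s"
    using lag_energy_comparable[OF \<alpha> c] by metis
  obtain \<kappa> where \<kappa>: "\<kappa> > 0"
    and ev: "eventually (\<lambda>n. lag_energy \<alpha> n (sqrt (c / real n)) \<ge> \<kappa> * sqrt (real n)) sequentially"
    using lag_energy_ge[OF \<alpha>] unfolding c_def by metis
  \<comment> \<open>\<open>K * n\<close> bounds the main part of the potential. \<open>D\<close>
    combines the bound 2 for the arctangent with a bound for the full potential, whose singular part
    is at most \<open>k / c * n\<close> to the right of \<open>c / n\<close>.\<close>
  define K where "K = 6 + 2 * \<alpha>"
  define k where "k = \<bar>1 / 4 - \<alpha>\<^sup>2\<bar>"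
  define D where "D = 2 * (K + k / c)"
  \<comment> \<open>Below this threshold the potential part \<open>K * n * h^2\<close> of the energy
    is at most half of its minimum \<open>F0 / \<Lambda>\<close>. Above it the trivial bound
    \<open>B\<close> for the measure suffices.\<close>
  define \<eta>0 where "\<eta>0 = sqrt (\<kappa> / (2 * \<Lambda> * K))"
  have K: "K > 0" using \<alpha> by (simp add: K_def)
  have D: "D > 0" using K c by (simp add: D_def k_def add_pos_nonneg)
  have \<eta>0: "\<eta>0 > 0" using \<kappa> \<Lambda> K by (simp add: \<eta>0_def)
  define C where "C = max (1 / \<eta>0) (8 * \<Lambda>\<^sup>2 / sqrt \<kappa> * (4 / sqrt c + D))"
  show thesis
  proof (rule that)
    show "C > 0" using \<eta>0 by (simp add: C_def less_max_iff_disj)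
    show "eventually (\<lambda>n. \<forall>\<eta> B. \<eta> > 0 \<longrightarrow> c / real n \<le> B \<longrightarrow> B \<le> real n \<longrightarrow>
           measure lebesgue {x \<in> {c / real n..B}. \<bar>lag_osc \<alpha> n (sqrt x)\<bar> \<le> \<eta> * real n powr (-1/4)} \<le> C * \<eta> * B)
         sequentially"
      using ev eventually_gt_at_top[of "0::nat"]
    proof (eventually_elim, intro allI impI)
      fix n :: nat and \<eta> B :: real
      define A where "A = c / real n"
      assume F0: "\<kappa> * sqrt (real n) \<le> lag_energy \<alpha> n (sqrt (c / real n))" and n: "0 < n"
        and \<eta>: "\<eta> > 0" and AB': "c / real n \<le> B" and Bn: "B \<le> real n"
      define F0 where "F0 = lag_energy \<alpha> n (sqrt (c / real n))"
      define h where "h = \<eta> * real n powr (-1/4)"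
      define S where "S = {x \<in> {A..B}. \<bar>lag_osc \<alpha> n (sqrt x)\<bar> \<le> h}"
      have AB: "A \<le> B" and A: "A > 0" using AB' c n by (auto simp: A_def)
      have B: "B > 0" using A AB by linarith
      have h: "h > 0" using \<eta> n by (simp add: h_def)
      have F0pos: "F0 > 0" using F0 \<kappa> n unfolding F0_def by (smt (verit) mult_pos_pos real_sqrt_gt_zero of_nat_0_less_iff)
      have cont: "continuous_on {A..B} (\<lambda>x. lag_osc \<alpha> n (sqrt x))"
      proof (rule continuous_on_compose2[of "{0<..}" "lag_osc \<alpha> n"])
        show "continuous_on {0<..} (lag_osc \<alpha> n)"
          by (intro continuous_at_imp_continuous_on ballI) (auto intro: DERIV_isCont DERIV_lag_osc)
      qed (use A in \<open>auto intro!: continuous_intros\<close>)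
      have "closed ({A..B} \<inter> (\<lambda>x. lag_osc \<alpha> n (sqrt x)) -` {-h..h})"
        by (rule continuous_closed_preimage[OF cont]) auto
      also have "{A..B} \<inter> (\<lambda>x. lag_osc \<alpha> n (sqrt x)) -` {-h..h} = S" by (auto simp: S_def)
      finally have "compact S"
        by (auto simp: compact_eq_bounded_closed S_def intro: bounded_subset[OF bounded_closed_interval])
      then have Sm: "S \<in> lmeasurable" by (rule lmeasurable_compact)
      have "measure lebesgue S \<le> C * \<eta> * B"
      proof (cases "\<eta> \<ge> \<eta>0")
        case True
        have "measure lebesgue S \<le> measure lebesgue {A..B}"
          using Sm by (intro measure_mono_fmeasurable) (auto simp: S_def fmeasurableD)
        also have "\<dots> \<le> 1 * B" using AB A by simp
        also have "1 \<le> C * \<eta>"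
        proof -
          have "1 \<le> 1 / \<eta>0 * \<eta>" using True \<eta>0 by (simp add: field_simps)
          also have "\<dots> \<le> C * \<eta>" using \<eta> by (intro mult_right_mono) (auto simp: C_def)
          finally show ?thesis .
        qed
        then have "1 * B \<le> C * \<eta> * B" using A AB by (intro mult_right_mono) auto
        finally show ?thesis .
      next
        case False
        have h2: "K * real n * h\<^sup>2 \<le> F0 / \<Lambda> / 2"
        proof -
          have "\<eta>\<^sup>2 \<le> \<eta>0\<^sup>2" using False \<eta> by (intro power_mono) auto
          also have "\<dots> = \<kappa> / (2 * \<Lambda> * K)" using \<kappa> \<Lambda> K by (simp add: \<eta>0_def)
          finally have "\<eta>\<^sup>2 \<le> \<kappa> / (2 * \<Lambda> * K)" .
          moreover have "real n * (real n powr (-1/4))\<^sup>2 = sqrt (real n)"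
            using n by (simp add: power2_eq_square powr_half_sqrt[symmetric] powr_mult_base flip: powr_add)
          then have "K * real n * h\<^sup>2 = K * \<eta>\<^sup>2 * sqrt (real n)"
            by (simp add: h_def power_mult_distrib)
          moreover have "K * \<eta>\<^sup>2 * sqrt (real n) \<le> K * (\<kappa> / (2 * \<Lambda> * K)) * sqrt (real n)"
            using K \<open>\<eta>\<^sup>2 \<le> \<kappa> / (2 * \<Lambda> * K)\<close> by (intro mult_right_mono mult_left_mono) auto
          ultimately have "K * real n * h\<^sup>2 \<le> K * (\<kappa> / (2 * \<Lambda> * K)) * sqrt (real n)" by (simp only:)
          also have "\<dots> = \<kappa> * sqrt (real n) / \<Lambda> / 2" using K \<Lambda> by simp
          also have "\<dots> \<le> F0 / \<Lambda> / 2" using F0 \<Lambda> by (intro divide_right_mono) (auto simp: F0_def)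
          finally show ?thesis .
        qed
        \<comment> \<open>\<open>e / (2 * sqrt x)\<close> dominates the term of \<open>G'\<close>
          that carries the potential, and its antiderivative is \<open>e * sqrt x\<close>.\<close>
        define e where "e = D * sqrt (real n) * sqrt (\<Lambda> * F0)"
        define G where "G x = arctan (lag_osc \<alpha> n (sqrt x) / h) * lag_osc' \<alpha> n (sqrt x)" for x
        define G' where "G' x = (h * (lag_osc' \<alpha> n (sqrt x))\<^sup>2 / (h\<^sup>2 + (lag_osc \<alpha> n (sqrt x))\<^sup>2) - arctan (lag_osc \<alpha> n (sqrt x) / h) *
        ((4 * real n + 2 * \<alpha> + 2 - (sqrt x)\<^sup>2 + (1 / 4 - \<alpha>\<^sup>2) / (sqrt x)\<^sup>2) * lag_osc \<alpha> n (sqrt x))) / (2 * sqrt x)" for x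
        have DG: "(G has_real_derivative G' x) (at x)" if "x > 0" for x
          unfolding G_def G'_def by (rule DERIV_osc_flux) (use that h in auto)
        have arctan2: "\<bar>arctan y\<bar> \<le> 2" for y
          using arctan_bounded[of y] pi_less_4 by (auto simp: abs_le_iff)
        have at_x: "3 * real n * (lag_osc \<alpha> n (sqrt x))\<^sup>2 + (lag_osc' \<alpha> n (sqrt x))\<^sup>2 \<le> \<Lambda> * F0"
          "lag_energy \<alpha> n (sqrt x) \<ge> F0 / \<Lambda>" if x: "A \<le> x" "x \<le> B" for x
        proof -
          have s: "sqrt (c / real n) \<le> sqrt x" "sqrt x \<le> sqrt (real n)" "0 \<le> sqrt x"
            using x A AB Bn by (auto simp: A_def)
          show "3 * real n * (lag_osc \<alpha> n (sqrt x))\<^sup>2 + (lag_osc' \<alpha> n (sqrt x))\<^sup>2 \<le> \<Lambda> * F0"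
            using lag_energy_lower[OF \<alpha> s(3,2)] comp[OF _ s(1,2)] n by (simp add: F0_def)
          show "lag_energy \<alpha> n (sqrt x) \<ge> F0 / \<Lambda>"
            using comp[OF _ s(1,2)] n \<Lambda> by (simp add: F0_def field_simps)
        qed
        have v_le: "sqrt (real n) * \<bar>lag_osc \<alpha> n (sqrt x)\<bar> \<le> sqrt (\<Lambda> * F0)" if "A \<le> x" "x \<le> B" for x
        proof -
          have "(sqrt (real n) * \<bar>lag_osc \<alpha> n (sqrt x)\<bar>)\<^sup>2 = real n * (lag_osc \<alpha> n (sqrt x))\<^sup>2"
            by (simp add: power_mult_distrib)
          also have "\<dots> \<le> \<Lambda> * F0"
            using at_x(1)[OF that] zero_le_power2[of "lag_osc' \<alpha> n (sqrt x)"]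
              mult_nonneg_nonneg[OF of_nat_0_le_iff zero_le_power2, of n "lag_osc \<alpha> n (sqrt x)"] by linarith
          finally show ?thesis by (rule real_le_rsqrt)
        qed
        have G_le: "\<bar>G x\<bar> \<le> 2 * sqrt (\<Lambda> * F0)" if "A \<le> x" "x \<le> B" for x
        proof -
          have "(lag_osc' \<alpha> n (sqrt x))\<^sup>2 \<le> \<Lambda> * F0"
            using at_x(1)[OF that]
              mult_nonneg_nonneg[OF of_nat_0_le_iff zero_le_power2, of n "lag_osc \<alpha> n (sqrt x)"] by linarith
          then have "\<bar>lag_osc' \<alpha> n (sqrt x)\<bar> \<le> sqrt (\<Lambda> * F0)" by (intro real_le_rsqrt) simp
          then show ?thesis unfolding G_def abs_mult by (intro mult_mono arctan2) auto
        qed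
        \<comment> \<open>On \<open>S\<close> at least half of the energy sits in
          \<open>v'^2\<close>. The 8 collects this half, the estimate
          \<open>h^2 + v^2 \<le> 2 * h^2\<close> and the factor \<open>2 * s\<close> of the
          substitution.\<close>
        have lower: "indicator S x * (F0 / \<Lambda> / (8 * h * sqrt B)) \<le> G' x + e * (1 / (2 * sqrt x))"
          if x: "x \<in> {A..B}" for x
        proof -
          define s v v' where "s = sqrt x" and "v = lag_osc \<alpha> n s" and "v' = lag_osc' \<alpha> n s"
          have s: "s > 0" "s \<le> sqrt B" "s\<^sup>2 = x" using x A by (auto simp: s_def)
          define Q where "Q = 4 * real n + 2 * \<alpha> + 2 - s\<^sup>2 + (1 / 4 - \<alpha>\<^sup>2) / s\<^sup>2"
          have n1: "1 \<le> real n" using n by simp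
          have Kn: "4 * real n + 2 * \<alpha> + 2 \<le> K * real n"
          proof -
            have "(2 + 2 * \<alpha>) * 1 \<le> (2 + 2 * \<alpha>) * real n" using n1 \<alpha> by (intro mult_left_mono) auto
            then show ?thesis by (simp add: K_def algebra_simps)
          qed
          have Q: "\<bar>Q\<bar> \<le> (K + k / c) * real n"
          proof -
            have "\<bar>(1 / 4 - \<alpha>\<^sup>2) / s\<^sup>2\<bar> = k / x" using s x A by (simp add: k_def)
            also have "\<dots> \<le> k / A" using x A by (intro divide_left_mono) (auto simp: k_def)
            also have "\<dots> = k / c * real n" by (simp add: A_def)
            finally have "\<bar>(1 / 4 - \<alpha>\<^sup>2) / s\<^sup>2\<bar> \<le> k / c * real n" .
            moreover have "\<bar>4 * real n + 2 * \<alpha> + 2 - s\<^sup>2\<bar> \<le> K * real n"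
              using Kn x A Bn \<alpha> n1 unfolding s(3) by auto
            ultimately show ?thesis unfolding Q_def distrib_right by linarith
          qed
          have "\<bar>arctan (v / h) * (Q * v)\<bar> \<le> 2 * ((K + k / c) * real n * \<bar>v\<bar>)"
            unfolding abs_mult using K c by (intro mult_mono arctan2 Q) (auto simp: k_def)
          also have "\<dots> = D * sqrt (real n) * (sqrt (real n) * \<bar>v\<bar>)" by (simp add: D_def)
          also have "\<dots> \<le> e"
            unfolding e_def using v_le[of x] x D by (intro mult_left_mono) (auto simp: v_def s_def)
          finally have *: "arctan (v / h) * (Q * v) \<le> e" by linarith
          have "indicator S x * (F0 / \<Lambda> / (8 * h * sqrt B)) \<le> h * v'\<^sup>2 / (h\<^sup>2 + v\<^sup>2) / (2 * s)"
          proof (cases "x \<in> S")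
            case True
            then have vh: "\<bar>v\<bar> \<le> h" by (simp add: S_def v_def s_def)
            then have v2: "v\<^sup>2 \<le> h\<^sup>2" by (simp add: abs_le_square_iff[symmetric])
            have "lag_energy \<alpha> n s = (4 * real n + 2 * \<alpha> + 2 - s\<^sup>2) * v\<^sup>2 + v'\<^sup>2"
              by (simp add: lag_energy_def v_def v'_def)
            also have "(4 * real n + 2 * \<alpha> + 2 - s\<^sup>2) * v\<^sup>2 \<le> K * real n * h\<^sup>2"
              using Kn s x A v2 K by (intro mult_mono) auto
            also have "\<dots> \<le> F0 / \<Lambda> / 2" by (rule h2)
            finally have v': "F0 / \<Lambda> / 2 \<le> v'\<^sup>2" using at_x(2)[of x] x by (simp add: s_def)
            have "F0 / \<Lambda> / (8 * h * sqrt B) = h * (F0 / \<Lambda> / 2) / (2 * h\<^sup>2) / (2 * sqrt B)"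
              using h by (simp add: power2_eq_square)
            also have "\<dots> \<le> h * v'\<^sup>2 / (h\<^sup>2 + v\<^sup>2) / (2 * s)"
              using v' h v2 s F0pos \<Lambda> by (intro frac_le mult_left_mono) (auto intro!: add_pos_nonneg)
            finally show ?thesis using True by simp
          qed (use h s in auto)
          also have "\<dots> \<le> h * v'\<^sup>2 / (h\<^sup>2 + v\<^sup>2) / (2 * s) + (e - arctan (v / h) * (Q * v)) / (2 * s)"
            using * s by simp
          also have "\<dots> = G' x + e * (1 / (2 * sqrt x))"
            by (simp add: G'_def v_def v'_def Q_def s_def diff_divide_distrib)
          finally show ?thesis .
        qed
        have "(indicator S has_integral measure lebesgue S) UNIV"
          using Sm by (simp add: lmeasurable_iff_has_integral)
        then have "((\<lambda>x. if x \<in> {A..B} then indicator S x else 0) has_integral measure lebesgue S) UNIV"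
          by (rule has_integral_eq_rhs[OF has_integral_eq[rotated]]) (auto simp: S_def indicator_def)
        then have "(indicator S has_integral measure lebesgue S) {A..B}"
          by (simp only: has_integral_restrict_UNIV)
        then have I1: "((\<lambda>x. indicator S x * (F0 / \<Lambda> / (8 * h * sqrt B))) has_integral
             measure lebesgue S * (F0 / \<Lambda> / (8 * h * sqrt B))) {A..B}"
          by (rule has_integral_mult_left)
        have I2: "((\<lambda>x. G' x + e * (1 / (2 * sqrt x))) has_integral
              (G B + e * sqrt B) - (G A + e * sqrt A)) {A..B}"
        proof (rule fundamental_theorem_of_calculus[OF AB])
          fix x assume "x \<in> {A..B}"
          then have "x > 0" using A by auto
          then have "((\<lambda>x. G x + e * sqrt x) has_real_derivative G' x + e * (1 / (2 * sqrt x))) (at x)"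
            using DERIV_real_sqrt[of x] by (intro DERIV_add DG DERIV_cmult) (auto simp: inverse_eq_divide mult.commute)
          then show "((\<lambda>x. G x + e * sqrt x) has_vector_derivative G' x + e * (1 / (2 * sqrt x))) (at x within {A..B})"
            by (simp add: has_real_derivative_iff_has_vector_derivative has_vector_derivative_at_within)
        qed
        have "measure lebesgue S * (F0 / \<Lambda> / (8 * h * sqrt B)) \<le> (G B + e * sqrt B) - (G A + e * sqrt A)"
          by (rule has_integral_le[OF I1 I2 lower])
        also have "\<dots> \<le> 4 * sqrt (\<Lambda> * F0) + e * sqrt B"
        proof -
          have "0 \<le> e * sqrt A" using A D \<Lambda> F0pos by (simp add: e_def)
          then show ?thesis using G_le[of A] G_le[of B] AB by linarith
        qed
        finally have "measure lebesgue S \<le> (4 * sqrt (\<Lambda> * F0) + e * sqrt B) / (F0 / \<Lambda> / (8 * h * sqrt B))"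
          using h B F0pos \<Lambda> by (subst pos_le_divide_eq) auto
        also have "\<dots> = 8 * h * sqrt B / (F0 / \<Lambda>) * (4 * sqrt (\<Lambda> * F0) + e * sqrt B)" by simp
        also have "\<dots> \<le> 8 * \<Lambda>\<^sup>2 / sqrt \<kappa> * (4 / sqrt c + D) * \<eta> * B"
          unfolding h_def e_def
        proof (rule small_ball_scaling[OF \<eta> \<Lambda> \<kappa> B _ c less_imp_le[OF D]])
          show "c \<le> real n * B" using AB n by (simp add: A_def pos_divide_le_eq mult.commute)
        qed (use n F0 in \<open>auto simp: F0_def\<close>)
        also have "\<dots> \<le> C * \<eta> * B"
          using \<eta> A AB by (intro mult_right_mono) (auto simp: C_def)
        finally show ?thesis .
      qed
      then show "measure lebesgue {x \<in> {c / real n..B}. \<bar>lag_osc \<alpha> n (sqrt x)\<bar> \<le> \<eta> * real n powr (-1/4)} \<le> C * \<eta> * B"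
        unfolding S_def h_def A_def .
    qed
  qed
qed

section \<open>The divergent expansion\<close>

lemma borel_measurable_poly [measurable]: "(\<lambda>x. poly q x :: real) \<in> borel_measurable borel"
  by (intro borel_measurable_continuous_onI continuous_intros)

lemma borel_measurable_laguerre_fun [measurable]: "laguerre_fun \<alpha> n \<in> borel_measurable borel"
  unfolding laguerre_fun_def[abs_def] by measurable

lemma borel_measurable_lag_osc [measurable]: "lag_osc \<alpha> n \<in> borel_measurable borel"
  unfolding lag_osc_def[abs_def] by measurable

lemma borel_measurable_lebesgue_on:
  "f \<in> borel_measurable borel \<Longrightarrow> f \<in> borel_measurable (lebesgue_on S)"
  for f :: "real \<Rightarrow> real"
  by (intro measurable_restrict_space1 measurable_completion) simp

lemma integrable_powr_tail:
  assumes "e < -1"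
  shows "integrable (lebesgue_on {0<..}) (\<lambda>x::real. indicator {1..} x * x powr e)"
proof -
  have "(\<lambda>x::real. x powr e) absolutely_integrable_on {1..}"
    using has_integral_powr_to_inf[OF assms, of 1]
    by (intro nonnegative_absolutely_integrable_1) auto
  then have "integrable lebesgue (\<lambda>x. indicator {1..} x *\<^sub>R x powr e)"
    by (simp add: set_integrable_def)
  moreover have "(\<lambda>x::real. indicator {0<..} x *\<^sub>R (indicator {1..} x * x powr e)) = (\<lambda>x. indicator {1..} x *\<^sub>R x powr e)"
    by (auto simp: indicator_def)
  ultimately show ?thesis
    by (subst integrable_restrict_space) (auto simp: set_integrable_def)
qed

lemma integrable_poly_weight:
  fixes \<alpha> :: real
  assumes "\<alpha> > -1"
  shows "integrable (lebesgue_on {0<..}) (\<lambda>x. poly q x * (exp (- x) * x powr \<alpha>))"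
proof -
  have "integrable (lebesgue_on {0<..}) (\<lambda>x. \<Sum>i\<le>degree q. coeff q i * (x ^ i * (exp (- x) * x powr \<alpha>)))"
    using has_bochner_integral_moment[OF assms]
    by (intro Bochner_Integration.integrable_sum integrable_mult_right) (auto simp: has_bochner_integral_iff)
  then show ?thesis by (simp only: poly_altdef sum_distrib_right mult.assoc)
qed

text \<open>Writing \<open>\<bar>L\<bar>\<close> as \<open>(x * \<bar>L\<bar>) * (1 / x)\<close>
  bounds it by \<open>(x * L)^2 + x powr (-2)\<close>. The first summand is a polynomial times the
  Laguerre weight, and the second is integrable on [1, oo).\<close>

lemma integrable_laguerre_fun_tail:
  assumes "\<alpha> > -1"
  shows "integrable (lebesgue_on {0<..}) (\<lambda>x. indicator {1..} x * \<bar>laguerre_fun \<alpha> n x\<bar>)"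
proof (rule Bochner_Integration.integrable_bound)
  let ?C = "sqrt (Gamma (real n + 1) / Gamma (real n + \<alpha> + 1))"
  let ?P = "laguerre_poly \<alpha> n"
  have "integrable (lebesgue_on {0<..})
      (\<lambda>x. ?C\<^sup>2 * (poly ([:0, 1:] * [:0, 1:] * ?P * ?P) x * (exp (- x) * x powr \<alpha>)) + indicator {1..} x * x powr (-2))"
    by (intro Bochner_Integration.integrable_add integrable_mult_right integrable_poly_weight assms integrable_powr_tail) auto
  also have "(\<lambda>x. ?C\<^sup>2 * (poly ([:0, 1:] * [:0, 1:] * ?P * ?P) x * (exp (- x) * x powr \<alpha>)) + indicator {1..} x * x powr (-2)) =
      (\<lambda>x. (x * laguerre_fun \<alpha> n x)\<^sup>2 + indicator {1..} x * x powr (-2))"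
  proof
    fix x :: real
    have 1: "exp (- x) = exp (- x / 2) * exp (- x / 2)" "x powr \<alpha> = x powr (\<alpha> / 2) * x powr (\<alpha> / 2)"
      by (simp_all flip: exp_add powr_add)
    show "?C\<^sup>2 * (poly ([:0, 1:] * [:0, 1:] * ?P * ?P) x * (exp (- x) * x powr \<alpha>)) + indicator {1..} x * x powr (-2) =
        (x * laguerre_fun \<alpha> n x)\<^sup>2 + indicator {1..} x * x powr (-2)"
      unfolding 1 by (simp add: laguerre_fun_def power2_eq_square mult_ac)
  qed
  finally show "integrable (lebesgue_on {0<..}) (\<lambda>x. (x * laguerre_fun \<alpha> n x)\<^sup>2 + indicator {1..} x * x powr (-2))" .
  show "(\<lambda>x. indicator {1..} x * \<bar>laguerre_fun \<alpha> n x\<bar>) \<in> borel_measurable (lebesgue_on {0<..})"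
    by (rule borel_measurable_lebesgue_on) measurable
  show "AE x in lebesgue_on {0<..}. norm (indicator {1..} x * \<bar>laguerre_fun \<alpha> n x\<bar>)
      \<le> norm ((x * laguerre_fun \<alpha> n x)\<^sup>2 + indicator {1..} x * x powr (-2))"
  proof (rule AE_I2)
    fix x :: real
    show "norm (indicator {1..} x * \<bar>laguerre_fun \<alpha> n x\<bar>)
      \<le> norm ((x * laguerre_fun \<alpha> n x)\<^sup>2 + indicator {1..} x * x powr (-2))"
    proof (cases "x \<ge> 1")
      case True
      let ?y = "x * \<bar>laguerre_fun \<alpha> n x\<bar>"
      have "0 \<le> (?y - 1 / x)\<^sup>2 + ?y\<^sup>2 + (1 / x)\<^sup>2" by simp
      also have "\<dots> = 2 * (?y\<^sup>2 + (1 / x)\<^sup>2 - \<bar>laguerre_fun \<alpha> n x\<bar>)"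
        using True by (simp add: power2_eq_square field_simps)
      finally have "\<bar>laguerre_fun \<alpha> n x\<bar> \<le> ?y\<^sup>2 + (1 / x)\<^sup>2" by simp
      then show ?thesis using True by (simp add: power_mult_distrib powr_minus powr_numeral power_divide inverse_eq_divide)
    qed simp
  qed
qed

lemma integrable_laguerre_fun_on:
  assumes "\<alpha> > -1" "J \<in> sets borel" "J \<subseteq> {1..}"
  shows "integrable (lebesgue_on {0<..}) (\<lambda>x. indicator J x * \<bar>laguerre_fun \<alpha> n x\<bar>)"
proof (rule Bochner_Integration.integrable_bound[OF integrable_laguerre_fun_tail[OF assms(1)]])
  show "(\<lambda>x. indicator J x * \<bar>laguerre_fun \<alpha> n x\<bar>) \<in> borel_measurable (lebesgue_on {0<..})"
    by (rule borel_measurable_lebesgue_on) (use assms(2) in measurable)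
  show "AE x in lebesgue_on {0<..}. norm (indicator J x * \<bar>laguerre_fun \<alpha> n x\<bar>)
      \<le> norm (indicator {1..} x * \<bar>laguerre_fun \<alpha> n x\<bar>)"
    using assms(3) by (intro AE_I2) (auto simp: indicator_def)
qed

lemma laguerre_fun_ge:
  assumes "x > 0" "\<bar>lag_osc \<alpha> n (sqrt x)\<bar> > h"
  shows "\<bar>laguerre_fun \<alpha> n x\<bar> > x powr (-1/4) * h"
proof -
  have "x powr (-1/4) * h < x powr (-1/4) * \<bar>lag_osc \<alpha> n (sqrt x)\<bar>"
    using assms by (intro mult_strict_left_mono) auto
  also have "\<dots> = \<bar>laguerre_fun \<alpha> n x\<bar>"
  proof -
    have "x powr (-1/4) * x powr (1/4) = 1" using assms(1) by (simp flip: powr_add)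
    moreover have "x powr (-1/4) * \<bar>lag_osc \<alpha> n (sqrt x)\<bar> =
        x powr (-1/4) * x powr (1/4) * \<bar>laguerre_fun \<alpha> n x\<bar>"
      by (simp only: lag_osc_sqrt[OF assms(1)] abs_mult abs_of_nonneg[OF powr_ge_zero] mult.assoc)
    ultimately show ?thesis by (simp only: mult_1)
  qed
  finally show ?thesis .
qed

lemma laguerre_fun_L1_lower:
  assumes \<alpha>: "\<alpha> > -1/2"
  obtains b where "b > 0"
    and "eventually (\<lambda>n. b * sqrt (real n) \<le>
      (LINT x|lebesgue_on {0<..}. indicator {real n / 4..real n} x * \<bar>laguerre_fun \<alpha> n x\<bar>)) sequentially"
proof -
  define c where "c = (\<alpha> + 1) / 4"
  obtain C where C: "C > 0" and ev: "eventually (\<lambda>n. \<forall>\<eta> B. \<eta> > 0 \<longrightarrow> c / real n \<le> B \<longrightarrow> B \<le> real n \<longrightarrow>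
           measure lebesgue {x \<in> {c / real n..B}. \<bar>lag_osc \<alpha> n (sqrt x)\<bar> \<le> \<eta> * real n powr (-1/4)} \<le> C * \<eta> * B)
         sequentially"
    by (rule lag_osc_small_ball[OF \<alpha>, folded c_def])
  \<comment> \<open>This choice makes the exceptional set of measure at most \<open>n / 4\<close>,
    while the interval has length \<open>3 * n / 4\<close>.\<close>
  define \<eta> where "\<eta> = 1 / (4 * C)"
  have \<eta>: "\<eta> > 0" using C by (simp add: \<eta>_def)
  have "eventually (\<lambda>n. c / real n \<le> real n / 4) sequentially" by real_asymp
  with ev eventually_ge_at_top[of 4]
  have "eventually (\<lambda>n. \<eta> / 2 * sqrt (real n) \<le>
      (LINT x|lebesgue_on {0<..}. indicator {real n / 4..real n} x * \<bar>laguerre_fun \<alpha> n x\<bar>)) sequentially"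
  proof eventually_elim
    case (elim n)
    let ?h = "\<eta> * real n powr (-1/4)"
    define S where "S = {x \<in> {c / real n..real n}. \<bar>lag_osc \<alpha> n (sqrt x)\<bar> \<le> ?h}"
    define G where "G = {real n / 4..real n} - S"
    have n: "real n \<ge> 4" using elim by simp
    have S_b: "S \<in> sets borel"
    proof -
      have "S = {c / real n..real n} \<inter> {x \<in> space borel. \<bar>lag_osc \<alpha> n (sqrt x)\<bar> \<le> ?h}" by (auto simp: S_def)
      also have "\<dots> \<in> sets borel" by measurable
      finally show ?thesis .
    qed
    then have Sm: "S \<in> lmeasurable"
      by (intro bounded_set_imp_lmeasurable) (auto simp: S_def intro: bounded_subset[OF bounded_closed_interval])
    have Gb: "G \<in> sets borel" unfolding G_def using S_b by auto
    have "c / real n \<le> real n" using elim by linarith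
    then have "measure lebesgue S \<le> C * \<eta> * real n"
      unfolding S_def by (intro elim(1)[rule_format, OF \<eta>] order_refl)
    also have "\<dots> = real n / 4" using C by (simp add: \<eta>_def)
    finally have "measure lebesgue {real n / 4..real n} - real n / 4 \<le> measure lebesgue {real n / 4..real n} - measure lebesgue S"
      by simp
    also have "\<dots> \<le> measure lebesgue G"
      unfolding G_def using Sm by (intro measure_diff_le_measure_setdiff) auto
    finally have mG: "real n / 2 \<le> measure lebesgue G" using n by simp
    have G0: "G \<subseteq> {0<..}" using n by (auto simp: G_def)
    have mG': "measure (lebesgue_on {0<..}) G = measure lebesgue G"
      using G0 by (intro measure_restrict_space) auto
    have fin: "emeasure (lebesgue_on {0<..}) G < \<infinity>"
    proof -
      have "G \<in> lmeasurable" using Gb by (intro bounded_set_imp_lmeasurable) (auto simp: G_def intro: bounded_subset[OF bounded_closed_interval])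
      then show ?thesis using G0 by (subst emeasure_restrict_space) (auto simp: fmeasurable_def)
    qed
    have Gs: "G \<in> sets (lebesgue_on {0<..})"
      using Gb G0 by (auto simp: sets_restrict_space_iff)
    \<comment> \<open>Off the exceptional set the bound is \<open>x powr (-1/4) * ?h\<close>; as
      \<open>x \<le> n\<close>, one more factor \<open>n powr (-1/4)\<close> is available.\<close>
    let ?e = "\<eta> * real n powr (-1/2)"
    have "\<eta> / 2 * sqrt (real n) = ?e * (real n / 2)"
    proof -
      have "real n powr (-1/2) * real n = sqrt (real n)"
        using n by (simp add: powr_minus_divide powr_half_sqrt real_div_sqrt)
      then show ?thesis by simp
    qed
    also have "\<dots> \<le> ?e * measure lebesgue G" using mG \<eta> by (intro mult_left_mono) auto
    also have "\<dots> = (LINT x|lebesgue_on {0<..}. ?e * indicator G x)"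
      using Gs G0 by (simp add: mG' space_restrict_space Int_absorb2)
    also have "\<dots> \<le> (LINT x|lebesgue_on {0<..}. indicator {real n / 4..real n} x * \<bar>laguerre_fun \<alpha> n x\<bar>)"
    proof (rule integral_mono)
      show "integrable (lebesgue_on {0<..}) (\<lambda>x. ?e * indicator G x)"
        using Gs fin by (intro integrable_mult_right integrable_real_indicator)
      show "integrable (lebesgue_on {0<..}) (\<lambda>x. indicator {real n / 4..real n} x * \<bar>laguerre_fun \<alpha> n x\<bar>)"
        by (rule integrable_laguerre_fun_on) (use \<alpha> n in auto)
      fix x
      show "?e * indicator G x \<le> indicator {real n / 4..real n} x * \<bar>laguerre_fun \<alpha> n x\<bar>"
      proof (cases "x \<in> G")
        case True
        then have x: "real n / 4 \<le> x" "x \<le> real n" "x \<notin> S" by (auto simp: G_def)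
        then have "\<bar>lag_osc \<alpha> n (sqrt x)\<bar> > ?h" using elim by (auto simp: S_def)
        then have "x powr (-1/4) * ?h < \<bar>laguerre_fun \<alpha> n x\<bar>" using x n by (intro laguerre_fun_ge) auto
        moreover have "?e = real n powr (-1/4) * ?h" by (simp flip: powr_add)
        moreover have "real n powr (-1/4) * ?h \<le> x powr (-1/4) * ?h"
          using x n \<eta> by (intro mult_right_mono powr_mono2') auto
        ultimately have "?e \<le> \<bar>laguerre_fun \<alpha> n x\<bar>" by linarith
        then show ?thesis using True x(1,2) by simp
      qed simp
    qed
    finally show ?case .
  qed
  then show thesis using that[of "\<eta> / 2"] \<eta> by simp
qed

text \<open>In the coefficient at \<open>n = N (Suc k)\<close> the block ending at \<open>n\<close>
  contributes at least \<open>b * n powr (1/2 - \<beta>)\<close>. Earlier blocks lie in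
  \<open>[1, N k]\<close> and cost at most \<open>N k\<close>, later ones cost at most 1 by
  \<open>tail\<close>, and \<open>grow\<close> makes the total loss at most half of the
  gain.\<close>

lemma laguerre_gliding_hump:
  fixes N :: "nat \<Rightarrow> nat"
  assumes \<alpha>: "\<alpha> > -1/2" and \<beta>: "\<beta> > 0" "1 < \<beta> * p" and b: "b > 0"
    and N4: "\<And>k. 4 \<le> N k" "\<And>k. 4 * N k < N (Suc k)"
    and L1: "\<And>k. b * sqrt (real (N k)) \<le>
      (LINT x|lebesgue_on {0<..}. indicator {real (N k) / 4..real (N k)} x * \<bar>laguerre_fun \<alpha> (N k) x\<bar>)"
    and tail: "\<And>k. (real (N (Suc k)) / 4) powr (- \<beta>) *
      (LINT x|lebesgue_on {0<..}. indicator {1..} x * \<bar>laguerre_fun \<alpha> (N k) x\<bar>) \<le> 1"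
    and grow: "\<And>k. real (N k) + 1 \<le> b / 2 * real (N (Suc k)) powr (1/2 - \<beta>)"
  obtains f where "in_Lp p (lebesgue_on {0<..}) f"
    and "\<And>k. b / 2 * real (N (Suc k)) powr (1/2 - \<beta>) \<le> laguerre_coeff \<alpha> f (N (Suc k))"
proof -
  let ?M = "lebesgue_on {0<..} :: real measure"
  define J where "J k = {real (N k) / 4..real (N k)}" for k
  \<comment> \<open>The blocks are disjoint, so at most one summand is nonzero at each point. As
    \<open>1 < \<beta> * p\<close> and all blocks lie in [1, oo), the weight puts \<open>f\<close>
    into the \<open>p\<close>-integrable functions.\<close>
  define f where "f x = x powr (- \<beta>) * (\<Sum>k. indicator (J k) x * sgn (laguerre_fun \<alpha> (N k) x))" for x :: real
  have f_meas [measurable]: "f \<in> borel_measurable borel"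
    unfolding f_def[abs_def] J_def by measurable
  have p: "p > 0" using zero_less_mult_pos[of \<beta> p] \<beta> by linarith
  have "N k < N (Suc k)" for k using N4(2)[of k] by simp
  then have "strict_mono N" by (rule strict_monoI_Suc)
  then have Nmono: "N i \<le> N j" if "i \<le> j" for i j
    using that by (simp add: strict_mono_less_eq)
  have sep: "real (N i) < real (N j) / 4" if "i < j" for i j
  proof -
    have "4 * N i < N j" using N4(2)[of i] Nmono[of "Suc i" j] that by simp
    then show ?thesis by simp
  qed
  have f_J: "f x = x powr (- \<beta>) * sgn (laguerre_fun \<alpha> (N k) x)" if "x \<in> J k" for x k
  proof -
    have "x \<notin> J i" if "i \<noteq> k" for i
      using \<open>x \<in> J k\<close> that sep[of i k] sep[of k i] by (auto simp: J_def neq_iff)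
    then have "(\<Sum>i. indicator (J i) x * sgn (laguerre_fun \<alpha> (N i) x)) =
        (\<Sum>i\<in>{k}. indicator (J i) x * sgn (laguerre_fun \<alpha> (N i) x))"
      by (intro suminf_finite) auto
    then show ?thesis using that by (simp add: f_def)
  qed
  have f_0: "f x = 0" if "\<And>k. x \<notin> J k" for x
    using that by (simp add: f_def)
  have J1: "1 \<le> x" if "x \<in> J k" for x k
    using that N4(1)[of k] by (auto simp: J_def)
  have f_bound: "\<bar>f x\<bar> \<le> indicator {1..} x * x powr (- \<beta>)" for x
  proof (cases "\<exists>k. x \<in> J k")
    case True
    then obtain k where k: "x \<in> J k" by blast
    then show ?thesis using J1[OF k] by (simp add: f_J abs_mult abs_sgn_eq)
  qed (auto simp: f_0)
  have Lp: "in_Lp p ?M f"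
    unfolding in_Lp_def
  proof
    show "f \<in> borel_measurable ?M" by (rule borel_measurable_lebesgue_on) measurable
    show "integrable ?M (\<lambda>x. \<bar>f x\<bar> powr p)"
    proof (rule Bochner_Integration.integrable_bound[OF integrable_powr_tail[of "- \<beta> * p"]])
      show "- \<beta> * p < -1" using \<beta> by simp
      show "(\<lambda>x. \<bar>f x\<bar> powr p) \<in> borel_measurable ?M" by (rule borel_measurable_lebesgue_on) measurable
      show "AE x in ?M. norm (\<bar>f x\<bar> powr p) \<le> norm (indicator {1..} x * x powr (- \<beta> * p))"
      proof (rule AE_I2)
        fix x
        have "\<bar>f x\<bar> powr p \<le> (indicator {1..} x * x powr (- \<beta>)) powr p"
          using f_bound[of x] p by (intro powr_mono2) auto
        also have "\<dots> = indicator {1..} x * x powr (- \<beta> * p)"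
          using p by (auto simp: indicator_def powr_powr)
        finally show "norm (\<bar>f x\<bar> powr p) \<le> norm (indicator {1..} x * x powr (- \<beta> * p))" by simp
      qed
    qed
  qed
  have coeff: "b / 2 * real (N (Suc k)) powr (1/2 - \<beta>) \<le> laguerre_coeff \<alpha> f (N (Suc k))" for k
  proof -
    define n where "n = N (Suc k)"
    define L where "L = laguerre_fun \<alpha> n"
    have [measurable]: "L \<in> borel_measurable borel" by (simp add: L_def)
    have n: "n > 0" using N4(1)[of "Suc k"] by (simp add: n_def)
    define R where "R = real (N (Suc (Suc k))) / 4"
    have R: "R > 0" using N4(1)[of "Suc (Suc k)"] by (simp add: R_def)
    have int_tail: "integrable ?M (\<lambda>x. indicator {1..} x * \<bar>L x\<bar>)"
      unfolding L_def by (rule integrable_laguerre_fun_tail) (use \<alpha> in simp)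
    have int_J: "integrable ?M (\<lambda>x. indicator (J (Suc k)) x * \<bar>L x\<bar>)"
      unfolding L_def by (rule integrable_laguerre_fun_on) (use \<alpha> N4(1)[of "Suc k"] in \<open>auto simp: J_def\<close>)
    have sq: "has_bochner_integral ?M (\<lambda>x. L x * L x) 1"
      using laguerre_fun_orthonormal[of \<alpha> n n] \<alpha> by (simp add: L_def)
    have I1: "has_bochner_integral ?M (indicator {1..real (N k)}) (real (N k) - 1)"
    proof -
      have "{1..real (N k)} \<in> sets ?M" by (auto simp: sets_restrict_space_iff)
      moreover have "emeasure ?M {1..real (N k)} = ennreal (real (N k) - 1)"
        using N4(1)[of k] by (subst emeasure_restrict_space) auto
      ultimately show ?thesis
        using has_bochner_integral_real_indicator[of "{1..real (N k)}" ?M] N4(1)[of k] by (simp add: measure_def)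
    qed
    \<comment> \<open>A minorant of \<open>f * L\<close> with one term each for the own block, the
      earlier blocks and the later blocks; \<open>R\<close> is the left end of the next
      block.\<close>
    let ?g = "\<lambda>x. real n powr (- \<beta>) * (indicator (J (Suc k)) x * \<bar>L x\<bar>) - (indicator {1..real (N k)} x + L x * L x)
        - R powr (- \<beta>) * (indicator {1..} x * \<bar>L x\<bar>)"
    have fL: "integrable ?M (\<lambda>x. f x * L x)"
    proof (rule Bochner_Integration.integrable_bound[OF int_tail])
      show "(\<lambda>x. f x * L x) \<in> borel_measurable ?M" by (rule borel_measurable_lebesgue_on) measurable
      have "\<bar>f x\<bar> \<le> indicator {1..} x" for x
      proof -
        have "x powr (- \<beta>) \<le> 1" if "x \<ge> 1"
          using that \<beta> powr_mono2'[of "\<beta>" 1 x] by (simp add: powr_minus_divide ge_one_powr_ge_zero)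
        then show ?thesis using f_bound[of x] by (auto simp: indicator_def split: if_splits)
      qed
      then show "AE x in ?M. norm (f x * L x) \<le> norm (indicator {1..} x * \<bar>L x\<bar>)"
        by (intro AE_I2) (simp add: abs_mult mult_right_mono)
    qed
    have "b / 2 * real n powr (1/2 - \<beta>) \<le> b * real n powr (1/2 - \<beta>) - real (N k) - 1"
      using grow[of k] by (simp add: n_def)
    also have "b * real n powr (1/2 - \<beta>) = real n powr (- \<beta>) * (b * sqrt (real n))"
      using n by (simp add: powr_diff powr_minus_divide powr_half_sqrt)
    also have "\<dots> - real (N k) - 1 \<le> real n powr (- \<beta>) * (LINT x|?M. indicator (J (Suc k)) x * \<bar>L x\<bar>)
        - (real (N k) - 1 + 1) - R powr (- \<beta>) * (LINT x|?M. indicator {1..} x * \<bar>L x\<bar>)"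
    proof -
      have "real n powr (- \<beta>) * (b * sqrt (real n)) \<le> real n powr (- \<beta>) * (LINT x|?M. indicator (J (Suc k)) x * \<bar>L x\<bar>)"
        using L1[of "Suc k"] by (intro mult_left_mono) (auto simp: J_def L_def n_def)
      then show ?thesis using tail[of "Suc k"] by (simp add: L_def n_def R_def)
    qed
    also have "\<dots> = (LINT x|?M. ?g x)"
      using int_J int_tail I1 sq by (simp add: has_bochner_integral_iff)
    also have "\<dots> \<le> (LINT x|?M. f x * L x)"
    proof (rule integral_mono[OF _ fL])
      show "integrable ?M ?g"
        using int_J int_tail I1 sq by (simp add: has_bochner_integral_iff)
      fix x
      have nn: "0 \<le> R powr (- \<beta>) * (indicator {1..} x * \<bar>L x\<bar>)" "0 \<le> L x * L x" "0 \<le> (indicator {1..real (N k)} x :: real)"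
        by (auto simp: indicator_def)
      show "?g x \<le> f x * L x"
      proof (cases "x \<in> J (Suc k)")
        case True
        have "real n powr (- \<beta>) * \<bar>L x\<bar> \<le> x powr (- \<beta>) * \<bar>L x\<bar>"
          using True J1[OF True] \<beta> by (intro mult_right_mono powr_mono2') (auto simp: J_def n_def)
        also have "\<dots> = f x * L x"
          using f_J[OF True] by (simp add: L_def n_def abs_sgn mult.commute)
        finally have "real n powr (- \<beta>) * (indicator (J (Suc k)) x * \<bar>L x\<bar>) \<le> f x * L x" using True by simp
        then show ?thesis using nn by linarith
      next
        case notJ: False
        then have J0: "indicator (J (Suc k)) x = (0 :: real)" by simp
        show ?thesis
        proof (cases "\<exists>i. x \<in> J i")
          case True
          then obtain i where i: "x \<in> J i" by blast
          have x1: "x \<ge> 1" using J1[OF i] .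
          have fx: "\<bar>f x\<bar> \<le> x powr (- \<beta>)" using f_bound[of x] x1 by simp
          consider "i \<le> k" | "Suc (Suc k) \<le> i" using notJ i by (metis not_less_eq_eq le_Suc_eq)
          then show ?thesis
          proof cases
            case 1
            then have "x \<in> {1..real (N k)}" using i x1 Nmono[of i k] by (auto simp: J_def)
            \<comment> \<open>On the earlier blocks the bound
              \<open>\<bar>L\<bar> \<le> 1 + L^2\<close> needs only the length of
              \<open>[1, N k]\<close> and the normalization of \<open>L\<close>.\<close>
            moreover have "- (f x * L x) \<le> 1 + L x * L x"
            proof -
              have "\<bar>f x\<bar> \<le> 1" using fx x1 \<beta> powr_mono2'[of "\<beta>" 1 x]
                by (smt (verit) ge_one_powr_ge_zero powr_minus_divide divide_le_eq_1)
              then have "\<bar>f x * L x\<bar> \<le> 1 * \<bar>L x\<bar>" unfolding abs_mult by (intro mult_right_mono) auto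
              moreover have "\<bar>L x\<bar> \<le> 1 + L x * L x"
              proof -
                have "0 \<le> (\<bar>L x\<bar> - 1)\<^sup>2 + \<bar>L x\<bar>" by simp
                then have "\<bar>L x\<bar> \<le> 1 + \<bar>L x\<bar> * \<bar>L x\<bar>" by (simp add: power2_eq_square algebra_simps)
                then show ?thesis by (simp add: abs_mult_self_eq)
              qed
              ultimately show ?thesis by linarith
            qed
            ultimately have "- (f x * L x) \<le> indicator {1..real (N k)} x + L x * L x" by simp
            with nn(1) show ?thesis unfolding J0 by linarith
          next
            case 2
            have "R \<le> x" using i Nmono[OF 2] by (auto simp: J_def R_def)
            then have "x powr (- \<beta>) \<le> R powr (- \<beta>)" using R \<beta> by (intro powr_mono2') auto
            then have "\<bar>f x\<bar> * \<bar>L x\<bar> \<le> R powr (- \<beta>) * \<bar>L x\<bar>" using fx by (intro mult_right_mono) auto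
            then have "- (f x * L x) \<le> R powr (- \<beta>) * \<bar>L x\<bar>"
              using abs_ge_minus_self[of "f x * L x"] unfolding abs_mult by linarith
            then have "- (f x * L x) \<le> R powr (- \<beta>) * (indicator {1..} x * \<bar>L x\<bar>)" using x1 by simp
            with nn(2,3) show ?thesis unfolding J0 by linarith
          qed
        next
          case False
          then have "f x * L x = 0" using f_0 by simp
          with nn show ?thesis unfolding J0 by linarith
        qed
      qed
    qed
    finally show ?thesis by (simp add: laguerre_coeff_def L_def n_def)
  qed
  show thesis using that[OF Lp coeff] .
qed

text \<open>The small-value estimate with \<open>\<eta> = N k powr (- \<epsilon>)\<close> gives
  exceptional sets in \<open>(0, m]\<close> whose measures are eventually dominated by a geometric
  series, so Borel-Cantelli applies. Countably many \<open>m\<close> cover the half-line.\<close>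

lemma AE_laguerre_fun_large:
  fixes N :: "nat \<Rightarrow> nat"
  assumes \<alpha>: "\<alpha> > -1/2"
    and N: "filterlim N at_top sequentially" "\<And>k. 0 < N k" "\<And>k. real (N k) powr (- \<epsilon>) \<le> (1 / 2) ^ k"
  shows "AE x in lebesgue_on {0<..}. eventually (\<lambda>k.
    x powr (-1/4) * real (N k) powr (- \<epsilon> - 1/4) < \<bar>laguerre_fun \<alpha> (N k) x\<bar>) sequentially"
proof -
  define c where "c = (\<alpha> + 1) / 4"
  obtain C where C: "C > 0" and ev: "eventually (\<lambda>n. \<forall>\<eta> B. \<eta> > 0 \<longrightarrow> c / real n \<le> B \<longrightarrow> B \<le> real n \<longrightarrow>
           measure lebesgue {x \<in> {c / real n..B}. \<bar>lag_osc \<alpha> n (sqrt x)\<bar> \<le> \<eta> * real n powr (-1/4)} \<le> C * \<eta> * B)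
         sequentially"
    by (rule lag_osc_small_ball[OF \<alpha>, folded c_def])
  define h where "h k = real (N k) powr (- \<epsilon>) * real (N k) powr (-1/4)" for k
  \<comment> \<open>The left endpoint tends to 0, so every positive \<open>x\<close> below
    \<open>m\<close> is eventually inside the interval.\<close>
  define S where "S m k = {x \<in> {c / real (N k)..real m}. \<bar>lag_osc \<alpha> (N k) (sqrt x)\<bar> \<le> h k}" for m k
  have evN: "eventually (\<lambda>k. c / real (N k) \<le> y) sequentially" if "y > 0" for y
  proof -
    have "eventually (\<lambda>n::nat. c / real n \<le> y) sequentially" using that by real_asymp
    then show ?thesis by (rule eventually_compose_filterlim[OF _ N(1)])
  qed
  have "AE x in lebesgue. eventually (\<lambda>k. x \<in> space lebesgue - S m k) sequentially" if m: "m > 0" for m :: nat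
  proof (rule borel_cantelli_AE1)
    fix k
    have "S m k = {c / real (N k)..real m} \<inter> {x \<in> space borel. \<bar>lag_osc \<alpha> (N k) (sqrt x)\<bar> \<le> h k}"
      by (auto simp: S_def)
    also have "\<dots> \<in> sets borel" by measurable
    finally show *: "S m k \<in> sets lebesgue" by simp
    then have "S m k \<in> lmeasurable"
      by (intro bounded_set_imp_lmeasurable) (auto simp: S_def intro: bounded_subset[OF bounded_closed_interval])
    then show "emeasure lebesgue (S m k) < \<infinity>"
      using fmeasurableD2[of "S m k" lebesgue] by (simp add: less_top del: emeasure_completion)
  next
    have "eventually (\<lambda>k. measure lebesgue (S m k) \<le> C * real m * (1 / 2) ^ k) sequentially"
    proof -
      have "eventually (\<lambda>k. real m \<le> real (N k)) sequentially"
        using eventually_compose_filterlim[OF eventually_ge_at_top[of m] N(1)] by simp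
      moreover have "eventually (\<lambda>k. c / real (N k) \<le> real m) sequentially" using m by (intro evN) simp
      ultimately show ?thesis
        using eventually_compose_filterlim[OF ev N(1)]
      proof eventually_elim
        case (elim k)
        have "measure lebesgue (S m k) \<le> C * real (N k) powr (- \<epsilon>) * real m"
          unfolding S_def h_def using elim N(2)[of k] by simp
        also have "\<dots> \<le> C * (1 / 2) ^ k * real m"
          using C N(3)[of k] by (intro mult_right_mono mult_left_mono) auto
        finally show ?case by (simp add: mult_ac)
      qed
    qed
    then show "summable (\<lambda>k. measure lebesgue (S m k))"
      by (intro summable_comparison_test_ev[OF _ summable_mult[OF summable_geometric[of "1/2::real"]], of _ "C * real m"])
         (auto elim: eventually_mono)
  qed
  then have "AE x in lebesgue. \<forall>m. m > 0 \<longrightarrow> eventually (\<lambda>k. x \<in> space lebesgue - S m k) sequentially"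
    by (simp add: AE_all_countable)
  then have "AE x in lebesgue. x \<in> {0<..} \<longrightarrow> eventually (\<lambda>k.
    x powr (-1/4) * real (N k) powr (- \<epsilon> - 1/4) < \<bar>laguerre_fun \<alpha> (N k) x\<bar>) sequentially"
  proof (rule eventually_mono, intro impI)
    fix x :: real
    assume *: "\<forall>m. m > 0 \<longrightarrow> eventually (\<lambda>k. x \<in> space lebesgue - S m k) sequentially" and x: "x \<in> {0<..}"
    obtain m :: nat where m: "x < real m" using reals_Archimedean2 by blast
    then have "m > 0" using x by (cases m) auto
    with * have "eventually (\<lambda>k. x \<notin> S m k) sequentially" by simp
    moreover have "eventually (\<lambda>k. c / real (N k) \<le> x) sequentially" using x by (intro evN) simp
    ultimately show "eventually (\<lambda>k.
      x powr (-1/4) * real (N k) powr (- \<epsilon> - 1/4) < \<bar>laguerre_fun \<alpha> (N k) x\<bar>) sequentially"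
    proof eventually_elim
      case (elim k)
      then have "\<bar>lag_osc \<alpha> (N k) (sqrt x)\<bar> > h k" using m by (auto simp: S_def)
      then have "x powr (-1/4) * h k < \<bar>laguerre_fun \<alpha> (N k) x\<bar>" using x by (intro laguerre_fun_ge) auto
      then show ?case by (simp add: h_def flip: powr_add)
    qed
  qed
  then show ?thesis by (subst AE_restrict_space_iff) auto
qed

text \<open>Convergence of either mean would bound it along the integers, and inversion would then
  bound the terms by a multiple of \<open>(n + 1) powr \<delta>\<close>. The surplus
  \<open>\<epsilon>\<close> in the exponent contradicts this.\<close>

lemma means_diverge:
  fixes N :: "nat \<Rightarrow> nat" and x :: real
  assumes \<delta>: "0 < \<delta>" "\<delta> < 1" and "\<epsilon> > 0" "b > 0"
    and N: "filterlim N at_top sequentially"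
    and large: "eventually (\<lambda>k. b * real (N k) powr (\<delta> + \<epsilon>) \<le>
        \<bar>laguerre_coeff \<alpha> f (N k) * laguerre_fun \<alpha> (N k) x\<bar>) sequentially"
  shows "\<not> (\<exists>l. ((\<lambda>N. cesaro_mean \<alpha> \<delta> f N x) \<longlongrightarrow> l) sequentially)"
    and "\<not> (\<exists>l. ((\<lambda>r. riesz_mean \<alpha> \<delta> f r x) \<longlongrightarrow> l) at_top)"
proof -
  define a where "a n = laguerre_coeff \<alpha> f n * laguerre_fun \<alpha> n x" for n
  have unbounded: False if M: "\<And>n. \<bar>a n\<bar> \<le> M * (real n + 1) powr \<delta>" for M
  proof -
    have "filterlim (\<lambda>n::nat. b * real n powr (\<delta> + \<epsilon>) - M * (real n + 1) powr \<delta>) at_top sequentially"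
      using assms(1,3,4) by real_asymp
    then have "eventually (\<lambda>n::nat. M * (real n + 1) powr \<delta> < b * real n powr (\<delta> + \<epsilon>)) sequentially"
      by (auto simp: filterlim_at_top_dense elim: allE[of _ 0])
    from eventually_compose_filterlim[OF this N] large
    have "eventually (\<lambda>k. False) sequentially"
    proof eventually_elim
      case (elim k)
      then show ?case using M[of "N k"] by (simp add: a_def)
    qed
    then show False by simp
  qed
  show "\<not> (\<exists>l. ((\<lambda>N. cesaro_mean \<alpha> \<delta> f N x) \<longlongrightarrow> l) sequentially)"
  proof
    assume "\<exists>l. ((\<lambda>N. cesaro_mean \<alpha> \<delta> f N x) \<longlongrightarrow> l) sequentially"
    then have "Bseq (\<lambda>N. cesaro_mean \<alpha> \<delta> f N x)"
      by (intro convergent_imp_Bseq) (simp add: convergent_def)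
    then obtain M where "\<And>n. \<bar>cesaro_mean \<alpha> \<delta> f n x\<bar> \<le> M" by (auto simp: Bseq_def)
    then have "\<bar>\<Sum>k\<le>n. cesaro_number \<delta> (n - k) / cesaro_number \<delta> n * a k\<bar> \<le> M" for n
      by (simp add: cesaro_mean_def a_def mult.assoc)
    then show False using cesaro_inversion[OF \<delta>, of a M] unbounded[of "8 * M"] by blast
  qed
  show "\<not> (\<exists>l. ((\<lambda>r. riesz_mean \<alpha> \<delta> f r x) \<longlongrightarrow> l) at_top)"
  proof
    assume "\<exists>l. ((\<lambda>r. riesz_mean \<alpha> \<delta> f r x) \<longlongrightarrow> l) at_top"
    then obtain l where l: "((\<lambda>r. riesz_mean \<alpha> \<delta> f r x) \<longlongrightarrow> l) at_top" by blast
    \<comment> \<open>Convergence as \<open>r\<close> grows does not bound the means for all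
      \<open>r\<close>; sampling at \<open>n + 1\<close> gives a convergent, hence bounded, sequence
      and the index set \<open>{..n}\<close>.\<close>
    have "filterlim (\<lambda>n::nat. real n + 1) at_top sequentially" by real_asymp
    from filterlim_compose[OF l this]
    have "Bseq (\<lambda>n. riesz_mean \<alpha> \<delta> f (real n + 1) x)"
      by (intro convergent_imp_Bseq) (auto simp: convergent_def)
    then obtain M where M: "\<And>n. \<bar>riesz_mean \<alpha> \<delta> f (real n + 1) x\<bar> \<le> M" by (auto simp: Bseq_def)
    have "{k. real k < real n + 1} = {..n}" for n by auto
    then have "\<bar>\<Sum>k\<le>n. (1 - real k / (real n + 1)) powr \<delta> * a k\<bar> \<le> M" for n
      using M[of n] by (simp add: riesz_mean_def a_def mult.assoc)
    then show False using riesz_inversion[OF \<delta>, of a M] unbounded[of "4 * M"] by blast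
  qed
qed

theorem theorem3p1:
  fixes \<alpha> p \<delta> :: real
  assumes "\<alpha> > -1/2" and "p > 4" and "0 < \<delta>" and "\<delta> < 1/4 - 1/p"
  shows "\<exists>f :: real \<Rightarrow> real. in_Lp p (lebesgue_on {0<..}) f \<and>
           (AE x in lebesgue_on {0<..}.
              \<not> (\<exists>l. ((\<lambda>N. cesaro_mean \<alpha> \<delta> f N x) \<longlongrightarrow> l) sequentially) \<and>
              \<not> (\<exists>l. ((\<lambda>r. riesz_mean \<alpha> \<delta> f r x) \<longlongrightarrow> l) at_top))"
proof -
  \<comment> \<open>The room in the exponent is split into three: one share for the integrability of
    the weight, one for the pointwise lower bound, and one as surplus over
    \<open>n powr \<delta>\<close>.\<close>
  define \<epsilon> where "\<epsilon> = (1/4 - 1/p - \<delta>) / 3"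
  define \<beta> where "\<beta> = 1/p + \<epsilon>"
  have \<epsilon>: "\<epsilon> > 0" using assms by (simp add: \<epsilon>_def)
  have \<beta>: "\<beta> > 0" "1 < \<beta> * p" using assms(2) \<epsilon> by (auto simp: \<beta>_def distrib_right add_pos_pos)
  have \<epsilon>\<beta>: "1/2 - \<beta> - \<epsilon> - 1/4 = \<delta> + \<epsilon>" by (simp add: \<beta>_def \<epsilon>_def field_simps)
  then have half: "1/2 - \<beta> > 0" using \<epsilon> assms(3) by simp
  obtain b where b: "b > 0" and L1: "eventually (\<lambda>n. b * sqrt (real n) \<le>
      (LINT x|lebesgue_on {0<..}. indicator {real n / 4..real n} x * \<bar>laguerre_fun \<alpha> n x\<bar>)) sequentially"
    by (rule laguerre_fun_L1_lower[OF assms(1)])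
  \<comment> \<open>\<open>P\<close> collects the conditions on a single index and \<open>Q\<close>
    those linking consecutive ones. Each holds for all large \<open>n\<close> once the previous
    index is fixed, so the sequence can be chosen recursively.\<close>
  define P where "P k n \<longleftrightarrow> 4 \<le> n \<and> real n powr (- \<epsilon>) \<le> (1 / 2) ^ k \<and> b * sqrt (real n) \<le>
      (LINT x|lebesgue_on {0<..}. indicator {real n / 4..real n} x * \<bar>laguerre_fun \<alpha> n x\<bar>)" for k n :: nat
  define T where "T m = (LINT x|lebesgue_on {0<..}. indicator {1..} x * \<bar>laguerre_fun \<alpha> m x\<bar>)" for m
  define Q where "Q m n \<longleftrightarrow> 4 * m < n \<and> (real n / 4) powr (- \<beta>) * T m \<le> 1 \<and>
      real m + 1 \<le> b / 2 * real n powr (1/2 - \<beta>)" for m n :: nat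
  have evP: "eventually (P k) sequentially" for k
  proof -
    have "(\<lambda>n::nat. real n powr (- \<epsilon>)) \<longlonglongrightarrow> 0" using \<epsilon> by real_asymp
    then have "eventually (\<lambda>n::nat. real n powr (- \<epsilon>) < (1 / 2) ^ k) sequentially"
      by (rule order_tendstoD(2)) simp
    with L1 eventually_ge_at_top[of 4] show ?thesis
      unfolding P_def by eventually_elim auto
  qed
  have evQ: "eventually (Q m) sequentially" for m
  proof -
    have "(\<lambda>n::nat. (real n / 4) powr (- \<beta>) * T m) \<longlonglongrightarrow> 0"
      by (rule tendsto_mult_left_zero) (use \<beta> in real_asymp)
    then have "eventually (\<lambda>n::nat. (real n / 4) powr (- \<beta>) * T m < 1) sequentially"
      by (rule order_tendstoD(2)) simp
    moreover have "filterlim (\<lambda>n::nat. b / 2 * real n powr (1/2 - \<beta>)) at_top sequentially"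
      using b half by real_asymp
    then have "eventually (\<lambda>n::nat. real m + 1 \<le> b / 2 * real n powr (1/2 - \<beta>)) sequentially"
      by (simp only: filterlim_at_top)
    ultimately show ?thesis using eventually_gt_at_top[of "4 * m"]
      unfolding Q_def by eventually_elim auto
  qed
  have "\<exists>N. \<forall>k. P k (N k) \<and> Q (N k) (N (Suc k))"
  proof (rule dependent_nat_choice)
    show "\<exists>n. P 0 n" using eventually_happens[OF evP] by auto
    show "\<exists>n'. P (Suc k) n' \<and> Q n n'" for n k
      using eventually_happens[OF eventually_conj[OF evP evQ]] by auto
  qed
  then obtain N where P: "\<And>k. P k (N k)" and Q: "\<And>k. Q (N k) (N (Suc k))" by blast
  obtain f where f: "in_Lp p (lebesgue_on {0<..}) f"
    and coeff: "\<And>k. b / 2 * real (N (Suc k)) powr (1/2 - \<beta>) \<le> laguerre_coeff \<alpha> f (N (Suc k))"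
    by (rule laguerre_gliding_hump[OF assms(1) \<beta> b, of N]) (use P Q in \<open>auto simp: P_def Q_def T_def\<close>)
  have "N k < N (Suc k)" for k using Q[of k] by (simp add: Q_def)
  then have "strict_mono N" by (rule strict_monoI_Suc)
  then have N: "filterlim N at_top sequentially" by (rule filterlim_subseq)
  have "AE x in lebesgue_on {0<..}. eventually (\<lambda>k.
    x powr (-1/4) * real (N k) powr (- \<epsilon> - 1/4) < \<bar>laguerre_fun \<alpha> (N k) x\<bar>) sequentially"
    by (rule AE_laguerre_fun_large[OF assms(1) N])
       (use P in \<open>auto simp: P_def intro: less_le_trans[of 0 "4::nat"]\<close>)
  moreover have "AE x in lebesgue_on {0<..}. x > (0::real)"
    by (rule AE_I2) (simp add: space_restrict_space)
  ultimately have "AE x in lebesgue_on {0<..}.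
              \<not> (\<exists>l. ((\<lambda>N. cesaro_mean \<alpha> \<delta> f N x) \<longlongrightarrow> l) sequentially) \<and>
              \<not> (\<exists>l. ((\<lambda>r. riesz_mean \<alpha> \<delta> f r x) \<longlongrightarrow> l) at_top)"
  proof eventually_elim
    case (elim x)
    have "eventually (\<lambda>k. b / 2 * x powr (-1/4) * real (N k) powr (\<delta> + \<epsilon>) \<le>
        \<bar>laguerre_coeff \<alpha> f (N k) * laguerre_fun \<alpha> (N k) x\<bar>) sequentially"
      \<comment> \<open>The coefficient bound is available for successor indices only, so
        \<open>k = 0\<close> is discarded.\<close>
      using elim(1) eventually_gt_at_top[of 0]
    proof eventually_elim
      case (elim k)
      then obtain j where j: "k = Suc j" by (cases k) auto
      have "real (N k) powr (\<delta> + \<epsilon>) = real (N k) powr (1/2 - \<beta>) * real (N k) powr (- \<epsilon> - 1/4)"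
        unfolding \<epsilon>\<beta>[symmetric] by (simp add: algebra_simps flip: powr_add)
      then have "b / 2 * x powr (-1/4) * real (N k) powr (\<delta> + \<epsilon>) =
          (b / 2 * real (N k) powr (1/2 - \<beta>)) * (x powr (-1/4) * real (N k) powr (- \<epsilon> - 1/4))"
        by simp
      also have "\<dots> \<le> \<bar>laguerre_coeff \<alpha> f (N k)\<bar> * \<bar>laguerre_fun \<alpha> (N k) x\<bar>"
        using elim(1) coeff[of j] b by (intro mult_mono) (auto simp: j)
      finally show ?case by (simp add: abs_mult)
    qed
    moreover have "1 / p > 0" using assms(2) by simp
    then have "\<delta> < 1" using assms(4) by linarith
    moreover have "b / 2 * x powr (-1/4) > 0" using b elim(2) by simp
    ultimately show ?case using means_diverge[OF assms(3) _ \<epsilon> _ N] by blast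
  qed
  then show ?thesis using f by blast
qed

end
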